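(* Let $k=\mathbb{C}$ and let $\mathfrak{g}$ be a nilpotent Lie algebra over $k$ of dimension at most $7$. Then there exists a complete Poisson commutative subalgebra $M$ of $S(\mathfrak{g})$ which is generated by elements of degree at most two.
   Context: $S(\mathfrak{g})=k[x_1,\dots,x_n]$ is the symmetric algebra ($x_1,\dots,x_n$ a basis of $\mathfrak{g}$), with Poisson bracket $\{f,g\}=\sum_{i,j}[x_i,x_j]\frac{\partial f}{\partial x_i}\frac{\partial g}{\partial x_j}$. A subalgebra $A$ is Poisson commutative if $\{f,g\}=0$ for all $f,g\in A$. For $\xi\in\mathfrak{g}^*$ let $\mathfrak{g}(\xi)=\{x\in\mathfrak{g}\mid \xi([x,y])=0\ \forall y\in\mathfrak{g}\}$; the index is $i(\mathfrak{g})=\min_{\xi}\dim\mathfrak{g}(\xi)$ and $c(\mathfrak{g})=(\dim\mathfrak{g}+i(\mathfrak{g}))/2$. Every Poisson commutative subalgebra $A$ of $S(\mathfrak{g})$ satisfies $\mathrm{trdeg}_k(A)\le c(\mathfrak{g})$; $A$ is called complete if equality holds. *)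

theory Defs
  imports Complex_Main "HOL-Library.Poly_Mapping" "HOL-Library.Extended_Real"
begin

section \<open>Polynomials in finitely many variables\<close>

text \<open>
  The type below has the variables \<open>X\<^sub>0, X\<^sub>1, X\<^sub>2, \<dots>\<close>; the ring \<open>k[X\<^sub>0, \<dots>, X\<^sub>n\<^sub>-\<^sub>1]\<close> is its subset
  \<open>poly_ring n\<close>. A monomial maps each variable to its exponent.
\<close>

type_synonym 'k mvpoly = "(nat \<Rightarrow>\<^sub>0 nat) \<Rightarrow>\<^sub>0 'k"

definition poly_ring :: "nat \<Rightarrow> 'k::zero mvpoly set" where
  "poly_ring n = {p. \<forall>m \<in> Poly_Mapping.keys p. Poly_Mapping.keys m \<subseteq> {..<n}}"

definition poly_const :: "'k::zero \<Rightarrow> 'k mvpoly" where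
  "poly_const c = Poly_Mapping.single 0 c"

definition poly_var :: "nat \<Rightarrow> 'k::zero_neq_one mvpoly" where
  "poly_var i = Poly_Mapping.single (Poly_Mapping.single i 1) 1"

definition monomial_degree :: "(nat \<Rightarrow>\<^sub>0 nat) \<Rightarrow> nat" where
  "monomial_degree m = (\<Sum>i\<in>Poly_Mapping.keys m. Poly_Mapping.lookup m i)"

text \<open>The total degree; the zero polynomial gets degree \<open>0\<close>.\<close>

definition total_degree :: "'k::zero mvpoly \<Rightarrow> nat" where
  "total_degree p = Max (insert 0 (monomial_degree ` Poly_Mapping.keys p))"

text \<open>
  In the next definition the truncated exponent subtraction is harmless: it only truncates for
  monomials not containing \<open>X\<^sub>i\<close>, whose coefficient is then multiplied by \<open>0\<close>.
\<close>

definition partial_deriv :: "nat \<Rightarrow> 'k::comm_ring_1 mvpoly \<Rightarrow> 'k mvpoly" where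
  "partial_deriv i p =
     (\<Sum>m\<in>Poly_Mapping.keys p. Poly_Mapping.single (m - Poly_Mapping.single i 1) (of_nat (Poly_Mapping.lookup m i) * Poly_Mapping.lookup p m))"

definition poly_subst :: "(nat \<Rightarrow> 'k::comm_ring_1 mvpoly) \<Rightarrow> 'k mvpoly \<Rightarrow> 'k mvpoly" where
  "poly_subst f p = (\<Sum>m\<in>Poly_Mapping.keys p. poly_const (Poly_Mapping.lookup p m) * (\<Prod>i\<in>Poly_Mapping.keys m. f i ^ Poly_Mapping.lookup m i))"


section \<open>Subalgebras and transcendence degree\<close>

definition closed_subalgebra_ops :: "'k::comm_ring_1 mvpoly set \<Rightarrow> bool" where
  "closed_subalgebra_ops A \<longleftrightarrow>
     range poly_const \<subseteq> A \<and> (\<forall>p\<in>A. \<forall>q\<in>A. p + q \<in> A \<and> p * q \<in> A)"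

definition subalgebra_of_poly_ring :: "nat \<Rightarrow> 'k::comm_ring_1 mvpoly set \<Rightarrow> bool" where
  "subalgebra_of_poly_ring n A \<longleftrightarrow> A \<subseteq> poly_ring n \<and> closed_subalgebra_ops A"

definition generated_subalgebra :: "'k::comm_ring_1 mvpoly set \<Rightarrow> 'k mvpoly set" where
  "generated_subalgebra G = closed_subalgebra_ops hull G"

definition algebraically_independent :: "nat \<Rightarrow> (nat \<Rightarrow> 'k::comm_ring_1 mvpoly) \<Rightarrow> bool" where
  "algebraically_independent d f \<longleftrightarrow> (\<forall>P \<in> poly_ring d. poly_subst f P = 0 \<longrightarrow> P = 0)"

definition trdeg :: "'k::comm_ring_1 mvpoly set \<Rightarrow> enat" where
  "trdeg A = Sup {enat d | d. \<exists>f. f ` {..<d} \<subseteq> A \<and> algebraically_independent d f}"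


section \<open>Lie algebras\<close>

locale lie_algebra = vector_space scale
  for scale :: "'k::field \<Rightarrow> 'g::ab_group_add \<Rightarrow> 'g" +
  fixes bracket :: "'g \<Rightarrow> 'g \<Rightarrow> 'g"
  assumes bracket_add_left: "bracket (x + y) z = bracket x z + bracket y z"
    and bracket_add_right: "bracket x (y + z) = bracket x y + bracket x z"
    and bracket_scale_left: "bracket (scale c x) y = scale c (bracket x y)"
    and bracket_scale_right: "bracket x (scale c y) = scale c (bracket x y)"
    and bracket_self: "bracket x x = 0"
    and jacobi: "bracket x (bracket y z) + bracket y (bracket z x) + bracket z (bracket x y) = 0"
begin

fun lower_central_series :: "nat \<Rightarrow> 'g set" where
  "lower_central_series 0 = UNIV"
| "lower_central_series (Suc j) = span {bracket x y | x y. y \<in> lower_central_series j}"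

definition nilpotent :: bool where
  "nilpotent \<longleftrightarrow> (\<exists>j. lower_central_series j = {0})"

definition dual_space :: "('g \<Rightarrow> 'k) set" where
  "dual_space = {\<xi>. Vector_Spaces.linear scale (*) \<xi>}"

definition stabilizer :: "('g \<Rightarrow> 'k) \<Rightarrow> 'g set" where
  "stabilizer \<xi> = {x. \<forall>y. \<xi> (bracket x y) = 0}"

definition index :: nat where
  "index = (LEAST d. \<exists>\<xi> \<in> dual_space. d = dim (stabilizer \<xi>))"

definition c_number :: real where
  "c_number = (real (dim UNIV) + real index) / 2"

end

text \<open>
  A Lie algebra with a basis \<open>x\<^sub>0, \<dots>, x\<^sub>n\<^sub>-\<^sub>1\<close> (so it has finite dimension \<open>n\<close>). Its symmetric algebra is
  \<open>poly_ring n\<close>, where the variable \<open>X\<^sub>i\<close> is the basis vector \<open>x\<^sub>i\<close>.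
\<close>

locale lie_algebra_with_basis = lie_algebra scale bracket
  for scale :: "'k::field \<Rightarrow> 'g::ab_group_add \<Rightarrow> 'g"
    and bracket :: "'g \<Rightarrow> 'g \<Rightarrow> 'g" +
  fixes n :: nat and x :: "nat \<Rightarrow> 'g"
  assumes basis_inj: "inj_on x {..<n}"
    and basis_independent: "independent (x ` {..<n})"
    and basis_span: "span (x ` {..<n}) = UNIV"
begin

definition to_symmetric_algebra :: "'g \<Rightarrow> 'k mvpoly" where
  "to_symmetric_algebra v = (\<Sum>i<n. poly_const (representation (x ` {..<n}) v (x i)) * poly_var i)"

definition poisson_bracket :: "'k mvpoly \<Rightarrow> 'k mvpoly \<Rightarrow> 'k mvpoly" where
  "poisson_bracket f g =
     (\<Sum>i<n. \<Sum>j<n. to_symmetric_algebra (bracket (x i) (x j)) * partial_deriv i f * partial_deriv j g)"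

definition poisson_commutative_subalgebra :: "'k mvpoly set \<Rightarrow> bool" where
  "poisson_commutative_subalgebra A \<longleftrightarrow>
     subalgebra_of_poly_ring n A \<and> (\<forall>f\<in>A. \<forall>g\<in>A. poisson_bracket f g = 0)"

definition complete_poisson_commutative_subalgebra :: "'k mvpoly set \<Rightarrow> bool" where
  "complete_poisson_commutative_subalgebra A \<longleftrightarrow>
     poisson_commutative_subalgebra A \<and> ereal_of_enat (trdeg A) = ereal c_number"

end

end

(*
  Write B_xi(u,v) = xi[u,v] and let 2r be the largest rank of B_xi; then c(g) = n - r.  A subalgebra of
  S(g) generated by c elements has transcendence degree at most c (count monomials), so it suffices to
  exhibit n - r commuting, algebraically independent elements of degree at most 2.  Independence
  is read off from constant directional derivatives: each element of the list has one that kills the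
  earlier elements but not the element itself.

  Take y in g, not central, with [y,g] central.
  * r = 1: all 4x4 Pfaffians of the forms B_xi vanish.  Hence C(y) is abelian, and for a complement
    a_0,...,a_m of C(y) the elements [y,a_0] a_i - [y,a_i] a_0 commute with C(y) and with each other.
  * Otherwise pass to a hyperplane h = {v. eta[y,v] = 0}, which is a subalgebra containing the centre,
    with c(h) = c(g).  If [y,g] is a line then h = C(y), and the rank drops because y lies in the
    radical of C(y) but generically not in that of g; otherwise dim Z(g) >= 2, and the rank on h
    drops by counting dimensions, unless dim g = 7, r = 2 and [y,g] = Z(g) has dimension 2.
  * In that last case C(y) is abelian of dimension 5 or is spanned by y, Z(g), p, q with w = [p,q] in Z(g).
    With [b,y] = w and [a,y] = z, the derivations ad a and ad b of C(y) are, up to the factor w,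
    Hamiltonian with quadratic Hamiltonians Q_a and Q_b, and z, w, y, Q_b, w a - z b - Q_a commute
    (with Q_b replaced by p if b centralises p and q).
*)
theory Submission
  imports Defs "HOL-Library.FuncSet"
begin

section \<open>Polynomial substitution and derivations\<close>

text \<open>Pfaffians turn a condition on ranks into algebra. A 4x4 Pfaffian of B_xi is a quadratic
  form in xi, so its vanishing for all xi is an identity in S(g), and commutation of degree-two
  elements is read off from such identities. This settles r = 1 directly; a larger r is lowered by
  passing to a subalgebra h of codimension one. Commuting elements of S(h) also commute in S(g), so
  only the numbers have to match: dim h - r(h) = n - r once the dimension and r both drop by one.
  The nonzero centre lies in every radical, which gives 2r < n if r > 0 and hence r <= 3 for n <= 7.
  The value r = 3 occurs only for n = 7, where h has dimension six and r(h) <= 2 by the same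
  inequality. The obstacle is r = 2: a six-dimensional h with two-dimensional centre still has room
  for rank four, so the drop to r = 1 can fail. This is what forces the separate construction in
  dimension seven.\<close>

lemma mvpoly_eq_sum_single:
  fixes p :: "'a \<Rightarrow>\<^sub>0 'k::comm_monoid_add"
  shows "p = (\<Sum>m\<in>Poly_Mapping.keys p. Poly_Mapping.single m (Poly_Mapping.lookup p m))"
  by (rule poly_mapping_eqI)
     (auto simp: lookup_sum lookup_single when_def in_keys_iff sum.delta' split: if_splits)

lemma mvpoly_induct [case_names single add]:
  fixes p :: "'a \<Rightarrow>\<^sub>0 'k::comm_monoid_add"
  assumes single: "\<And>m c. P (Poly_Mapping.single m c)" and add: "\<And>p q. P p \<Longrightarrow> P q \<Longrightarrow> P (p + q)"
  shows "P p"
proof -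
  have "P (\<Sum>m\<in>A. Poly_Mapping.single m (Poly_Mapping.lookup p m))" if "finite A" for A
    using that
  proof (induction A)
    case empty
    show ?case using single[of undefined 0] by simp
  qed (simp add: single add)
  then show ?thesis
    using mvpoly_eq_sum_single[of p] by (metis finite_keys)
qed

definition monom_subst :: "(nat \<Rightarrow> 'k::comm_ring_1 mvpoly) \<Rightarrow> (nat \<Rightarrow>\<^sub>0 nat) \<Rightarrow> 'k mvpoly" where
  "monom_subst f m = (\<Prod>i\<in>Poly_Mapping.keys m. f i ^ Poly_Mapping.lookup m i)"

text \<open>\<open>m\<close>, \<open>m'\<close> and \<open>m + m'\<close> have different supports,
  so their products are compared over one common index set. The later \<open>_superset\<close>
  lemmas do the same for sums.\<close>

lemma monom_subst_superset:
  "finite A \<Longrightarrow> Poly_Mapping.keys m \<subseteq> A \<Longrightarrow> monom_subst f m = (\<Prod>i\<in>A. f i ^ Poly_Mapping.lookup m i)"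
  unfolding monom_subst_def by (rule prod.mono_neutral_left) (auto simp: in_keys_iff)

lemma monom_subst_0 [simp]: "monom_subst f 0 = 1"
  by (simp add: monom_subst_def)

lemma monom_subst_add: "monom_subst f (m + m') = monom_subst f m * monom_subst f m'"
  using Poly_Mapping.keys_add[of m m']
  by (simp add: monom_subst_superset[of "Poly_Mapping.keys m \<union> Poly_Mapping.keys m'"]
      lookup_add power_add prod.distrib)

lemma poly_const_0 [simp]: "poly_const 0 = 0"
  and poly_const_1 [simp]: "poly_const 1 = 1"
  by (simp_all add: poly_const_def)

lemma poly_const_add: "poly_const (a + b) = poly_const a + poly_const b"
  by (simp add: poly_const_def single_add)

lemma poly_const_mult: "poly_const (a * b) = poly_const a * poly_const b"
  by (simp add: poly_const_def mult_single)

lemma poly_const_minus: "poly_const (- a) = - poly_const (a::'k::comm_ring_1)"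
  by (simp add: poly_const_def single_uminus)

lemma poly_const_eq_0_iff [simp]: "poly_const c = 0 \<longleftrightarrow> c = 0"
  unfolding poly_const_def by (metis lookup_single_eq lookup_zero single_zero)

lemma poly_subst_superset:
  assumes "finite A" "Poly_Mapping.keys p \<subseteq> A"
  shows "poly_subst f p = (\<Sum>m\<in>A. poly_const (Poly_Mapping.lookup p m) * monom_subst f m)"
  unfolding poly_subst_def monom_subst_def[symmetric] using assms
  by (intro sum.mono_neutral_left) (auto simp: in_keys_iff)

lemma poly_subst_add: "poly_subst f (p + q) = poly_subst f p + poly_subst f q"
  using Poly_Mapping.keys_add[of p q]
  by (simp add: poly_subst_superset[of "Poly_Mapping.keys p \<union> Poly_Mapping.keys q"]
      lookup_add poly_const_add distrib_right sum.distrib)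

lemma poly_subst_single: "poly_subst f (Poly_Mapping.single m c) = poly_const c * monom_subst f m"
  using poly_subst_superset[of "{m}" "Poly_Mapping.single m c" f] by simp

lemma poly_subst_mult: "poly_subst f (p * q) = poly_subst f p * poly_subst f q"
proof (induction p rule: mvpoly_induct)
  case (single m c)
  show ?case
  proof (induction q rule: mvpoly_induct)
    case (single m' c')
    show ?case
      by (simp add: mult_single poly_subst_single monom_subst_add poly_const_mult algebra_simps)
  qed (simp add: distrib_left poly_subst_add)
qed (simp add: distrib_right poly_subst_add)

lemma poly_subst_0 [simp]: "poly_subst f 0 = 0"
  by (simp add: poly_subst_def)

lemma poly_subst_const [simp]: "poly_subst f (poly_const c) = poly_const c"
  using poly_subst_single[of f 0 c] by (simp add: poly_const_def)

lemma poly_subst_1 [simp]: "poly_subst f 1 = 1"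
  using poly_subst_const[of f 1] by simp

lemma poly_subst_var [simp]: "poly_subst f (poly_var i) = f i"
  unfolding poly_var_def by (simp add: poly_subst_single monom_subst_def)

lemma poly_subst_sum: "poly_subst f (sum g A) = (\<Sum>a\<in>A. poly_subst f (g a))"
  by (induction A rule: infinite_finite_induct) (auto simp: poly_subst_add)

lemma poly_subst_power: "poly_subst f (p ^ e) = poly_subst f p ^ e"
  by (induction e) (auto simp: poly_subst_mult)

lemma poly_subst_prod: "poly_subst f (prod g A) = (\<Prod>a\<in>A. poly_subst f (g a))"
  by (induction A rule: infinite_finite_induct) (auto simp: poly_subst_mult)

lemma poly_subst_poly_subst:
  "poly_subst f (poly_subst g p) = poly_subst (\<lambda>i. poly_subst f (g i)) p"
proof (induction p rule: mvpoly_induct)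
  case (single m c)
  show ?case
    by (simp add: poly_subst_single poly_subst_mult monom_subst_def poly_subst_prod poly_subst_power)
qed (simp add: poly_subst_add)

lemma poly_subst_cong:
  assumes "p \<in> poly_ring d" "\<And>i. i < d \<Longrightarrow> f i = g i"
  shows "poly_subst f p = poly_subst g p"
  unfolding poly_subst_def using assms unfolding poly_ring_def
  by (intro sum.cong arg_cong2[where f="(*)"] prod.cong) (auto, metis lessThan_iff subsetD)

lemma monom_subst_var: "monom_subst poly_var m = (Poly_Mapping.single m 1 :: 'k::comm_ring_1 mvpoly)"
proof -
  have pow: "(poly_var i :: 'k mvpoly) ^ e = Poly_Mapping.single (Poly_Mapping.single i e) 1" for i e
    by (induction e) (auto simp: poly_var_def mult_single single_add[symmetric])
  have "(\<Prod>i\<in>A. (Poly_Mapping.single (g i) 1 :: 'k mvpoly)) = Poly_Mapping.single (sum g A) 1"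
    for g :: "nat \<Rightarrow> nat \<Rightarrow>\<^sub>0 nat" and A
    by (induction A rule: infinite_finite_induct) (auto simp: mult_single)
  then show ?thesis
    by (simp add: monom_subst_def pow mvpoly_eq_sum_single[symmetric])
qed

lemma poly_subst_var_id: "poly_subst poly_var p = p"
  by (induction p rule: mvpoly_induct)
     (simp_all add: poly_subst_add poly_subst_single monom_subst_var poly_const_def mult_single)

lemma poly_ring_add: "p \<in> poly_ring d \<Longrightarrow> q \<in> poly_ring d \<Longrightarrow> p + q \<in> poly_ring d"
  using Poly_Mapping.keys_add[of p q] unfolding poly_ring_def by blast

lemma poly_ring_const [simp]: "poly_const c \<in> poly_ring d"
  unfolding poly_ring_def poly_const_def by auto

lemma poly_ring_0 [simp]: "0 \<in> poly_ring d"
  unfolding poly_ring_def by simp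

lemma poly_ring_1 [simp]: "1 \<in> poly_ring d"
  unfolding poly_ring_def by simp

lemma poly_ring_var [simp]: "i < d \<Longrightarrow> poly_var i \<in> poly_ring d"
  unfolding poly_ring_def poly_var_def by auto

lemma poly_ring_mult: "p \<in> poly_ring d \<Longrightarrow> q \<in> poly_ring d \<Longrightarrow> p * q \<in> poly_ring d"
  unfolding poly_ring_def
proof safe
  fix m i
  assume p: "\<forall>m\<in>Poly_Mapping.keys p. Poly_Mapping.keys m \<subseteq> {..<d}"
    and q: "\<forall>m\<in>Poly_Mapping.keys q. Poly_Mapping.keys m \<subseteq> {..<d}"
    and m: "m \<in> Poly_Mapping.keys (p * q)" and i: "i \<in> Poly_Mapping.keys m"
  from m obtain a b where "a \<in> Poly_Mapping.keys p" "b \<in> Poly_Mapping.keys q" "m = a + b"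
    using keys_mult[of p q] by blast
  then show "i < d"
    using p q i Poly_Mapping.keys_add[of a b] by blast
qed

lemma poly_ring_sum: "(\<And>a. a \<in> A \<Longrightarrow> g a \<in> poly_ring d) \<Longrightarrow> sum g A \<in> poly_ring d"
  by (induction A rule: infinite_finite_induct) (auto simp: poly_ring_add)

lemma poly_ring_minus: "p \<in> poly_ring d \<Longrightarrow> - p \<in> poly_ring d" for p :: "'k::comm_ring_1 mvpoly"
proof -
  assume "p \<in> poly_ring d"
  then have "poly_const (-1) * p \<in> poly_ring d" by (intro poly_ring_mult poly_ring_const)
  then show "- p \<in> poly_ring d" by (simp add: poly_const_minus)
qed

lemma poly_ring_diff: "p \<in> poly_ring d \<Longrightarrow> q \<in> poly_ring d \<Longrightarrow> p - q \<in> poly_ring d"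
  for p :: "'k::comm_ring_1 mvpoly"
  using poly_ring_add[of p d "- q"] poly_ring_minus[of q d] by simp

text \<open>Since \<open>poly_subst poly_var p = p\<close>, a polynomial is an expression built from
  constants and variables by sums and products. The principle reduces identities of derivations to
  the variables.\<close>

lemma poly_ring_induct [consumes 1, case_names const var add mult]:
  fixes p :: "'k::comm_ring_1 mvpoly"
  assumes p: "p \<in> poly_ring d"
    and const: "\<And>c. P (poly_const c)" and var: "\<And>i. i < d \<Longrightarrow> P (poly_var i)"
    and add: "\<And>p q. P p \<Longrightarrow> P q \<Longrightarrow> P (p + q)" and mult: "\<And>p q. P p \<Longrightarrow> P q \<Longrightarrow> P (p * q)"
  shows "P p"
proof -
  have P1: "P 1" and P0: "P 0" using const[of 1] const[of 0] by auto
  have pow: "P (poly_var i ^ e)" if "i < d" for i e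
    by (induction e) (auto simp: P1 mult var that)
  have prod: "P (\<Prod>i\<in>A. poly_var i ^ e i)" if "A \<subseteq> {..<d}" for A e
    using finite_subset[OF that] that by (induction A rule: finite_induct) (auto simp: P1 mult pow)
  have sum: "P (\<Sum>m\<in>A. g m)" if "finite A" "\<And>m. m \<in> A \<Longrightarrow> P (g m)"
    for A and g :: "(nat \<Rightarrow>\<^sub>0 nat) \<Rightarrow> 'k mvpoly"
    using that by (induction A rule: finite_induct) (auto simp: P0 add)
  have "P (poly_subst poly_var p)"
    unfolding poly_subst_def using p
    by (intro sum mult const prod) (auto simp: poly_ring_def)
  then show ?thesis by (simp add: poly_subst_var_id)
qed

section \<open>Partial derivatives and their coefficients\<close>

lemma partial_deriv_superset:
  assumes "finite A" "Poly_Mapping.keys p \<subseteq> A"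
  shows "partial_deriv i p = (\<Sum>m\<in>A. Poly_Mapping.single (m - Poly_Mapping.single i 1)
           (of_nat (Poly_Mapping.lookup m i) * Poly_Mapping.lookup p m))"
  unfolding partial_deriv_def using assms
  by (intro sum.mono_neutral_left) (auto simp: in_keys_iff)

lemma partial_deriv_add: "partial_deriv i (p + q) = partial_deriv i p + partial_deriv i q"
  using Poly_Mapping.keys_add[of p q]
  by (simp add: partial_deriv_superset[of "Poly_Mapping.keys p \<union> Poly_Mapping.keys q"]
      lookup_add distrib_left single_add sum.distrib)

lemma partial_deriv_single:
  "partial_deriv i (Poly_Mapping.single m c) =
     Poly_Mapping.single (m - Poly_Mapping.single i 1) (of_nat (Poly_Mapping.lookup m i) * c)"
  using partial_deriv_superset[of "{m}" "Poly_Mapping.single m c" i] by simp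

lemma partial_deriv_const [simp]: "partial_deriv i (poly_const c) = 0"
  unfolding poly_const_def by (simp add: partial_deriv_single)

lemma partial_deriv_var: "partial_deriv i (poly_var j) = (if i = j then 1 else 0)"
  unfolding poly_var_def by (auto simp: partial_deriv_single lookup_single when_def)

text \<open>Both sides are additive in \<open>p\<close> and in \<open>q\<close>, so monomials
  suffice. The exponent subtraction commutes with adding another monomial unless it truncates, and
  then the coefficient is zero; hence the case splits in \<open>1\<close> and
  \<open>2\<close>.\<close>

lemma partial_deriv_mult:
  "partial_deriv i (p * q) = partial_deriv i p * q + p * partial_deriv i q"
proof (induction p rule: mvpoly_induct)
  case (single m c)
  show ?case
  proof (induction q rule: mvpoly_induct)
    case (single m' c')
    let ?e = "Poly_Mapping.single i (1::nat)"
    have shift: "a - ?e + b = a + b - ?e" if "Poly_Mapping.lookup a i \<noteq> 0" for a b :: "nat \<Rightarrow>\<^sub>0 nat"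
      using that by (intro poly_mapping_eqI) (auto simp: lookup_add lookup_minus lookup_single when_def)
    have 1: "Poly_Mapping.single (m - ?e + m') (of_nat (Poly_Mapping.lookup m i) * c * c')
        = Poly_Mapping.single (m + m' - ?e) (of_nat (Poly_Mapping.lookup m i) * c * c')"
      by (cases "Poly_Mapping.lookup m i = 0") (simp_all add: shift[simplified])
    have 2: "Poly_Mapping.single (m + (m' - ?e)) (c * (of_nat (Poly_Mapping.lookup m' i) * c'))
        = Poly_Mapping.single (m + m' - ?e) (c * (of_nat (Poly_Mapping.lookup m' i) * c'))"
      by (cases "Poly_Mapping.lookup m' i = 0") (simp_all add: shift[simplified] add.commute[of m])
    show ?case
      by (simp only: mult_single partial_deriv_single 1 2 single_add[symmetric])
         (simp add: lookup_add algebra_simps)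
  qed (simp add: distrib_left partial_deriv_add algebra_simps)
qed (simp add: distrib_right partial_deriv_add algebra_simps)

lemma lookup_partial_deriv:
  "Poly_Mapping.lookup (partial_deriv i p) m =
     of_nat (Poly_Mapping.lookup m i + 1) * Poly_Mapping.lookup p (m + Poly_Mapping.single i 1)"
proof (induction p rule: mvpoly_induct)
  case (single m' c)
  let ?e = "Poly_Mapping.single i (1::nat)"
  show ?case
  proof (cases "Poly_Mapping.lookup m' i = 0")
    case True
    then have "m' \<noteq> m + ?e" by (auto simp: lookup_add)
    then show ?thesis using True by (simp add: partial_deriv_single lookup_single)
  next
    case False
    then have eq: "m' = m + ?e \<longleftrightarrow> m' - ?e = m"
      by (auto simp: poly_mapping_eq_iff fun_eq_iff lookup_add lookup_minus lookup_single when_def)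
    show ?thesis
    proof (cases "m' = m + ?e")
      case True
      then show ?thesis by (simp add: partial_deriv_single lookup_add)
    next
      case False
      then show ?thesis using eq by (simp add: partial_deriv_single lookup_single)
    qed
  qed
qed (simp add: partial_deriv_add lookup_add algebra_simps)


section \<open>Derivations and a criterion for algebraic independence\<close>

definition is_derivation :: "('k::comm_ring_1 mvpoly \<Rightarrow> 'k mvpoly) \<Rightarrow> bool" where
  "is_derivation D \<longleftrightarrow> (\<forall>p q. D (p + q) = D p + D q) \<and> (\<forall>p q. D (p * q) = D p * q + p * D q) \<and>
     (\<forall>c. D (poly_const c) = 0)"

lemma poly_ring_partial_deriv:
  assumes "p \<in> poly_ring d"
  shows "partial_deriv i p \<in> poly_ring d"
  unfolding poly_ring_def
proof safe
  fix m j
  assume m: "m \<in> Poly_Mapping.keys (partial_deriv i p)" and j: "j \<in> Poly_Mapping.keys m"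
  from m have "m + Poly_Mapping.single i 1 \<in> Poly_Mapping.keys p"
    by (auto simp: in_keys_iff lookup_partial_deriv)
  moreover have "j \<in> Poly_Mapping.keys (m + Poly_Mapping.single i 1)"
    using j by (simp add: in_keys_iff lookup_add)
  ultimately show "j < d" using assms by (auto simp: poly_ring_def)
qed

lemma derivation_0: "is_derivation D \<Longrightarrow> D 0 = 0"
  unfolding is_derivation_def by (metis poly_const_0)

text \<open>The chain rule: both sides obey the Leibniz rule along the substitution, so it is enough
  to compare them on the variables.\<close>

lemma derivation_poly_subst:
  assumes D: "is_derivation D" and P: "P \<in> poly_ring d"
  shows "D (poly_subst f P) = (\<Sum>j<d. poly_subst f (partial_deriv j P) * D (f j))"
  using P
proof (induction rule: poly_ring_induct)
  case (const c)
  then show ?case using D by (simp add: is_derivation_def)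
next
  case (var i)
  then show ?case
    by (simp add: partial_deriv_var if_distrib[of "poly_subst f"] if_distrib[of "\<lambda>x. x * _"]
        cong: if_cong)
next
  case (add p q)
  then show ?case using D
    by (simp add: is_derivation_def poly_subst_add partial_deriv_add distrib_right sum.distrib)
next
  case (mult p q)
  then show ?case using D
    by (simp add: is_derivation_def poly_subst_add poly_subst_mult partial_deriv_mult distrib_right
        sum.distrib sum_distrib_left sum_distrib_right algebra_simps)
qed

lemma poly_ring_SucD:
  assumes "P \<in> poly_ring (Suc d)" "\<forall>m\<in>Poly_Mapping.keys P. Poly_Mapping.lookup m d = 0"
  shows "P \<in> poly_ring d"
  unfolding poly_ring_def
proof safe
  fix m i assume m: "m \<in> Poly_Mapping.keys P" "i \<in> Poly_Mapping.keys m"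
  then have "i < Suc d" using assms(1) unfolding poly_ring_def by blast
  moreover have "i \<noteq> d" using assms(2) m by (auto simp: in_keys_iff)
  ultimately show "i < d" by simp
qed

text \<open>Applying \<open>D\<close> to a relation P(f) = 0 leaves, by the chain rule, only the
  derivative of P in the last variable times D(f_d). As D(f_d) is nonzero, that derivative is again
  a relation, of lower degree in the last variable, and vanishes by induction. In characteristic
  zero P then omits the last variable, and the independence of the first \<open>d\<close> elements
  applies.\<close>

lemma algebraically_independent_extend:
  fixes f :: "nat \<Rightarrow> 'k::{idom,ring_char_0} mvpoly"
  assumes D: "is_derivation D" and D0: "\<And>i. i < d \<Longrightarrow> D (f i) = 0" and Dd: "D (f d) \<noteq> 0"
    and indep: "algebraically_independent d f"
  shows "algebraically_independent (Suc d) f"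
proof -
  have "P = 0"
    if "P \<in> poly_ring (Suc d)" "poly_subst f P = 0" "\<forall>m\<in>Poly_Mapping.keys P. Poly_Mapping.lookup m d \<le> N"
    for P N using that
  proof (induction N arbitrary: P)
    case 0
    then show ?case using indep poly_ring_SucD unfolding algebraically_independent_def by auto
  next
    case (Suc N)
    have "D 0 = 0" by (rule derivation_0[OF D])
    then have "0 = (\<Sum>j<Suc d. poly_subst f (partial_deriv j P) * D (f j))"
      using derivation_poly_subst[OF D Suc.prems(1), of f] Suc.prems(2) by simp
    also have "\<dots> = poly_subst f (partial_deriv d P) * D (f d)"
      using D0 by simp
    finally have "poly_subst f (partial_deriv d P) = 0" using Dd by simp
    moreover have "\<forall>m\<in>Poly_Mapping.keys (partial_deriv d P). Poly_Mapping.lookup m d \<le> N"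
    proof
      fix m assume "m \<in> Poly_Mapping.keys (partial_deriv d P)"
      then have "m + Poly_Mapping.single d 1 \<in> Poly_Mapping.keys P"
        by (auto simp: in_keys_iff lookup_partial_deriv)
      then show "Poly_Mapping.lookup m d \<le> N"
        using Suc.prems(3) by (fastforce simp: lookup_add)
    qed
    ultimately have dP: "partial_deriv d P = 0"
      by (rule Suc.IH[OF poly_ring_partial_deriv[OF Suc.prems(1)]])
    have "Poly_Mapping.lookup m d = 0" if "m \<in> Poly_Mapping.keys P" for m
    proof (rule ccontr)
      assume ne: "Poly_Mapping.lookup m d \<noteq> 0"
      let ?e = "Poly_Mapping.single d (1::nat)"
      have "m - ?e + ?e = m"
        using ne by (intro poly_mapping_eqI) (auto simp: lookup_add lookup_minus lookup_single when_def)
      then have "of_nat (Poly_Mapping.lookup (m - ?e) d + 1) * Poly_Mapping.lookup P m = 0"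
        using lookup_partial_deriv[of d P "m - ?e"] dP by simp
      then have "Poly_Mapping.lookup P m = 0"
        by (simp only: mult_eq_0_iff of_nat_eq_0_iff) simp
      then show False using that by (simp add: in_keys_iff)
    qed
    then have "P \<in> poly_ring d" using poly_ring_SucD[OF Suc.prems(1)] by simp
    then show ?case using indep Suc.prems(2) unfolding algebraically_independent_def by blast
  qed
  moreover have "\<exists>N. \<forall>m\<in>Poly_Mapping.keys P. Poly_Mapping.lookup m d \<le> N" for P :: "'k mvpoly"
    by (rule exI[of _ "\<Sum>m\<in>Poly_Mapping.keys P. Poly_Mapping.lookup m d"]) (auto intro: member_le_sum)
  ultimately show ?thesis unfolding algebraically_independent_def by blast
qed

lemma algebraically_independent_0: "algebraically_independent 0 f"
  unfolding algebraically_independent_def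
proof safe
  fix P assume P: "P \<in> poly_ring 0" and s: "poly_subst f P = 0"
  have "poly_subst f P = poly_subst poly_var P" using P by (rule poly_subst_cong) simp
  then show "P = 0" using s by (simp add: poly_subst_var_id)
qed

section \<open>Degrees, generated subalgebras and transcendence degree\<close>

lemma total_degree_le_iff: "total_degree p \<le> D \<longleftrightarrow> (\<forall>m\<in>Poly_Mapping.keys p. monomial_degree m \<le> D)"
  unfolding total_degree_def by auto

lemma monomial_degree_superset:
  "finite A \<Longrightarrow> Poly_Mapping.keys m \<subseteq> A \<Longrightarrow> monomial_degree m = (\<Sum>i\<in>A. Poly_Mapping.lookup m i)"
  unfolding monomial_degree_def by (rule sum.mono_neutral_left) (auto simp: in_keys_iff)

lemma monomial_degree_add: "monomial_degree (m + m') = monomial_degree m + monomial_degree m'"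
  using Poly_Mapping.keys_add[of m m']
  by (simp add: monomial_degree_superset[of "Poly_Mapping.keys m \<union> Poly_Mapping.keys m'"]
      lookup_add sum.distrib)

lemma total_degree_add_le: "total_degree p \<le> D \<Longrightarrow> total_degree q \<le> D \<Longrightarrow> total_degree (p + q) \<le> D"
  using Poly_Mapping.keys_add[of p q] unfolding total_degree_le_iff by blast

lemma total_degree_mult_le:
  assumes "total_degree p \<le> D" "total_degree q \<le> E"
  shows "total_degree (p * q) \<le> D + E"
  unfolding total_degree_le_iff
proof
  fix m assume "m \<in> Poly_Mapping.keys (p * q)"
  then obtain a b where "a \<in> Poly_Mapping.keys p" "b \<in> Poly_Mapping.keys q" "m = a + b"
    using keys_mult[of p q] by blast
  then show "monomial_degree m \<le> D + E"
    using assms unfolding total_degree_le_iff by (auto simp: monomial_degree_add add_mono)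
qed

lemma total_degree_const: "total_degree (poly_const c) = 0"
  by (simp add: total_degree_def poly_const_def monomial_degree_def)

lemma total_degree_var: "total_degree (poly_var i) \<le> 1"
  by (simp add: total_degree_le_iff poly_var_def monomial_degree_def)

lemma total_degree_sum_le: "(\<And>a. a \<in> A \<Longrightarrow> total_degree (g a) \<le> D) \<Longrightarrow> total_degree (sum g A) \<le> D"
proof (induction A rule: infinite_finite_induct)
  case (insert a A)
  then show ?case by (simp add: total_degree_add_le)
qed (auto simp: total_degree_le_iff)

lemma closed_generated_subalgebra: "closed_subalgebra_ops (generated_subalgebra G)"
  unfolding generated_subalgebra_def by (rule hull_in) (auto simp: closed_subalgebra_ops_def)

lemma generated_subalgebra_superset: "G \<subseteq> generated_subalgebra G"
  unfolding generated_subalgebra_def by (rule hull_subset)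

lemma generated_subalgebra_minimal:
  "G \<subseteq> A \<Longrightarrow> closed_subalgebra_ops A \<Longrightarrow> generated_subalgebra G \<subseteq> A"
  unfolding generated_subalgebra_def by (rule hull_minimal)

lemma closed_subalgebra_poly_ring: "closed_subalgebra_ops (poly_ring n :: 'k::comm_ring_1 mvpoly set)"
  unfolding closed_subalgebra_ops_def by (auto simp: poly_ring_add poly_ring_mult)

lemma closed_poly_subst_image: "closed_subalgebra_ops (poly_subst f ` poly_ring d)"
  unfolding closed_subalgebra_ops_def
proof (intro conjI ballI)
  show "range poly_const \<subseteq> poly_subst f ` poly_ring d"
    by (metis image_subsetI image_eqI poly_subst_const poly_ring_const)
next
  fix p q assume "p \<in> poly_subst f ` poly_ring d" "q \<in> poly_subst f ` poly_ring d"
  then obtain p' q' where "p = poly_subst f p'" "q = poly_subst f q'" "p' \<in> poly_ring d" "q' \<in> poly_ring d"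
    by blast
  then show "p + q \<in> poly_subst f ` poly_ring d" "p * q \<in> poly_subst f ` poly_ring d"
    by (metis image_eqI poly_subst_add poly_ring_add, metis image_eqI poly_subst_mult poly_ring_mult)
qed

section \<open>Algebraic dependence by counting monomials\<close>

definition bounded_monomials :: "nat \<Rightarrow> nat \<Rightarrow> (nat \<Rightarrow>\<^sub>0 nat) set" where
  "bounded_monomials c K = {m. Poly_Mapping.keys m \<subseteq> {..<c} \<and> (\<forall>i. Poly_Mapping.lookup m i \<le> K)}"

lemma bounded_monomials_mono: "K \<le> L \<Longrightarrow> bounded_monomials c K \<subseteq> bounded_monomials c L"
  unfolding bounded_monomials_def using order_trans by blast

lemma finite_card_bounded_monomials:
  "finite (bounded_monomials c K) \<and> card (bounded_monomials c K) = (K + 1) ^ c"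
proof -
  let ?F = "PiE {..<c} (\<lambda>_. {..K})"
  let ?g = "\<lambda>m :: nat \<Rightarrow>\<^sub>0 nat. restrict (Poly_Mapping.lookup m) {..<c}"
  have "bij_betw ?g (bounded_monomials c K) ?F"
  proof (rule bij_betwI')
    fix m m' assume mm: "m \<in> bounded_monomials c K" "m' \<in> bounded_monomials c K"
    show "(?g m = ?g m') = (m = m')"
    proof
      assume eq: "?g m = ?g m'"
      show "m = m'"
      proof (rule poly_mapping_eqI)
        fix i show "Poly_Mapping.lookup m i = Poly_Mapping.lookup m' i"
        proof (cases "i < c")
          case True
          then show ?thesis using fun_cong[OF eq, of i] by simp
        next
          case False
          then have "i \<notin> Poly_Mapping.keys m" "i \<notin> Poly_Mapping.keys m'"
            using mm by (auto simp: bounded_monomials_def)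
          then show ?thesis by (simp add: in_keys_iff)
        qed
      qed
    qed simp
  next
    fix m assume "m \<in> bounded_monomials c K"
    then show "?g m \<in> ?F" by (auto simp: bounded_monomials_def)
  next
    fix h assume h: "h \<in> ?F"
    let ?m = "Abs_poly_mapping (\<lambda>i. if i < c then h i else 0)"
    have lk: "Poly_Mapping.lookup ?m = (\<lambda>i. if i < c then h i else 0)"
      by (rule lookup_Abs_poly_mapping) (rule finite_subset[of _ "{..<c}"], auto)
    have "?m \<in> bounded_monomials c K"
      unfolding bounded_monomials_def using h by (auto simp: in_keys_iff lk PiE_iff split: if_splits)
    moreover have "h = ?g ?m" using h by (auto simp: lk fun_eq_iff PiE_iff extensional_def)
    ultimately show "\<exists>m\<in>bounded_monomials c K. h = ?g m" by blast
  qed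
  moreover have "finite ?F" "card ?F = (K + 1) ^ c" by (auto simp: finite_PiE card_PiE)
  ultimately show ?thesis by (metis bij_betw_finite bij_betw_same_card)
qed

lemma keys_prod_power_bounded:
  fixes G :: "nat \<Rightarrow> 'k::comm_ring_1 mvpoly"
  assumes "finite A" "\<And>i. i \<in> A \<Longrightarrow> Poly_Mapping.keys (G i) \<subseteq> bounded_monomials c D"
  shows "Poly_Mapping.keys (\<Prod>i\<in>A. G i ^ e i) \<subseteq> bounded_monomials c (\<Sum>i\<in>A. e i * D)"
proof -
  have one: "Poly_Mapping.keys (1::'k mvpoly) \<subseteq> bounded_monomials c 0"
    by (auto simp: bounded_monomials_def)
  have mult: "Poly_Mapping.keys (p * q) \<subseteq> bounded_monomials c (K + L)"
    if "Poly_Mapping.keys p \<subseteq> bounded_monomials c K" "Poly_Mapping.keys q \<subseteq> bounded_monomials c L"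
    for p q :: "'k mvpoly" and K L
  proof
    fix m assume "m \<in> Poly_Mapping.keys (p * q)"
    then obtain a b where "a \<in> Poly_Mapping.keys p" "b \<in> Poly_Mapping.keys q" "m = a + b"
      using keys_mult[of p q] by blast
    moreover have "a \<in> bounded_monomials c K" "b \<in> bounded_monomials c L"
      using calculation that by auto
    ultimately show "m \<in> bounded_monomials c (K + L)"
      using Poly_Mapping.keys_add[of a b] by (auto simp: bounded_monomials_def lookup_add add_mono)
  qed
  have power: "Poly_Mapping.keys (p ^ k) \<subseteq> bounded_monomials c (k * D)"
    if "Poly_Mapping.keys p \<subseteq> bounded_monomials c D" for p :: "'k mvpoly" and k
  proof (induction k)
    case 0
    show ?case using one by simp
  next
    case (Suc k)
    then show ?case using mult[OF that Suc] by simp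
  qed
  show ?thesis using assms
  proof (induction A rule: finite_induct)
    case empty
    show ?case using one by simp
  next
    case (insert a A)
    then show ?case by (simp add: mult power)
  qed
qed

text \<open>The (N+1)^d products of the \<open>G i\<close> with exponents at most N lie in a space
  spanned by (dND+1)^c monomials, where D bounds the exponents in the \<open>G i\<close>. As c < d,
  a large N forces a linear dependence, which is a relation. Bounding each exponent separately makes
  both counts exact powers.\<close>

lemma exists_algebraic_relation:
  fixes G :: "nat \<Rightarrow> 'k::field mvpoly"
  assumes G: "\<And>i. i < d \<Longrightarrow> G i \<in> poly_ring c" and cd: "c < d"
  shows "\<exists>P\<in>poly_ring d. P \<noteq> 0 \<and> poly_subst G P = 0"
proof -
  interpret mv: vector_space "\<lambda>(a::'k) p. poly_const a * (p :: 'k mvpoly)"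
    by unfold_locales (simp_all add: algebra_simps poly_const_add poly_const_mult)
  have "\<exists>D. \<forall>i<d. Poly_Mapping.keys (G i) \<subseteq> bounded_monomials c D"
  proof -
    let ?D = "\<Sum>i<d. \<Sum>m\<in>Poly_Mapping.keys (G i). \<Sum>j\<in>Poly_Mapping.keys m. Poly_Mapping.lookup m j"
    have "Poly_Mapping.lookup m j \<le> ?D" if "i < d" "m \<in> Poly_Mapping.keys (G i)" for i m j
    proof (cases "j \<in> Poly_Mapping.keys m")
      case True
      have "Poly_Mapping.lookup m j \<le> (\<Sum>j\<in>Poly_Mapping.keys m. Poly_Mapping.lookup m j)"
        using True by (intro member_le_sum) auto
      also have "\<dots> \<le> (\<Sum>m\<in>Poly_Mapping.keys (G i). \<Sum>j\<in>Poly_Mapping.keys m. Poly_Mapping.lookup m j)"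
        using that(2) by (intro member_le_sum) auto
      also have "\<dots> \<le> ?D" using that(1) by (intro member_le_sum) auto
      finally show ?thesis .
    qed (simp add: in_keys_iff)
    then show ?thesis using G unfolding bounded_monomials_def poly_ring_def by blast
  qed
  then obtain D where D: "\<And>i. i < d \<Longrightarrow> Poly_Mapping.keys (G i) \<subseteq> bounded_monomials c D" by blast
  \<comment> \<open>With this value the constant (dD+1)^c equals N itself, so that (dND+1)^c <=
    N(N+1)^c < (N+1)^(c+1).\<close>
  define N where "N = (d * D + 1) ^ c"
  let ?A = "bounded_monomials d N" and ?B = "bounded_monomials c (d * N * D)"
  let ?T = "(\<lambda>m. Poly_Mapping.single m (1::'k)) ` ?B"
  have cardAB: "card ?B < card ?A"
  proof -
    have "(d * N * D + 1) ^ c \<le> ((d * D + 1) * (N + 1)) ^ c"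
      by (rule power_mono) (auto simp: algebra_simps)
    also have "\<dots> = N * (N + 1) ^ c" by (simp only: power_mult_distrib N_def)
    also have "\<dots> < (N + 1) ^ Suc c" by simp
    also have "\<dots> \<le> (N + 1) ^ d" using cd by (intro power_increasing) auto
    finally show ?thesis by (simp add: finite_card_bounded_monomials)
  qed
  have finA: "finite ?A" and finT: "finite ?T" by (auto simp: finite_card_bounded_monomials)
  have cardT: "card ?T \<le> card ?B" by (rule card_image_le) (simp add: finite_card_bounded_monomials)
  have span: "monom_subst G m \<in> mv.span ?T" if m: "m \<in> ?A" for m
  proof -
    have "monom_subst G m = (\<Prod>i<d. G i ^ Poly_Mapping.lookup m i)"
      using m by (intro monom_subst_superset) (auto simp: bounded_monomials_def)
    then have "Poly_Mapping.keys (monom_subst G m)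
        \<subseteq> bounded_monomials c (\<Sum>i<d. Poly_Mapping.lookup m i * D)"
      using keys_prod_power_bounded[of "{..<d}" G c D "Poly_Mapping.lookup m"] D by simp
    moreover have "(\<Sum>i<d. Poly_Mapping.lookup m i * D) \<le> (\<Sum>i<d. N * D)"
      using m by (intro sum_mono mult_right_mono) (auto simp: bounded_monomials_def)
    ultimately have sub: "Poly_Mapping.keys (monom_subst G m) \<subseteq> ?B"
      using bounded_monomials_mono[of _ "\<Sum>i<d. N * D" c] by (fastforce simp: mult.assoc)
    have "(\<Sum>k\<in>Poly_Mapping.keys (monom_subst G m).
        poly_const (Poly_Mapping.lookup (monom_subst G m) k) * Poly_Mapping.single k (1::'k)) \<in> mv.span ?T"
      using sub by (intro mv.span_sum mv.span_scale mv.span_base) blast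
    then show ?thesis
      using mvpoly_eq_sum_single[of "monom_subst G m"] by (simp add: poly_const_def mult_single)
  qed
  have "\<exists>a. (\<exists>m\<in>?A. a m \<noteq> 0) \<and> (\<Sum>m\<in>?A. poly_const (a m) * monom_subst G m) = 0"
  \<comment> \<open>Linear dependence concerns the set of values, so two exponents with equal values
    are treated apart; they give a relation with coefficients 1 and -1.\<close>
  proof (cases "inj_on (monom_subst G) ?A")
    case False
    then obtain m1 m2 where m: "m1 \<in> ?A" "m2 \<in> ?A" "m1 \<noteq> m2" "monom_subst G m1 = monom_subst G m2"
      by (auto simp: inj_on_def)
    let ?a = "\<lambda>m. if m = m1 then 1 else if m = m2 then -1 else (0::'k)"
    have "(\<Sum>m\<in>?A. poly_const (?a m) * monom_subst G m)
        = (\<Sum>m\<in>{m1, m2}. poly_const (?a m) * monom_subst G m)"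
      using m finA by (intro sum.mono_neutral_right) auto
    also have "\<dots> = 0" using m by (simp add: poly_const_minus)
    finally show ?thesis using m(1) by (intro exI[of _ ?a]) auto
  next
    case True
    have "mv.dependent (monom_subst G ` ?A)"
    proof (rule ccontr)
      assume "\<not> mv.dependent (monom_subst G ` ?A)"
      then have "card (monom_subst G ` ?A) \<le> card ?T"
        using mv.independent_span_bound[OF finT, of "monom_subst G ` ?A"] span by blast
      then show False using cardAB cardT card_image[OF True] by simp
    qed
    then obtain u where u: "\<exists>v\<in>monom_subst G ` ?A. u v \<noteq> 0"
      "(\<Sum>v\<in>monom_subst G ` ?A. poly_const (u v) * v) = 0"
      using mv.dependent_finite[of "monom_subst G ` ?A"] finA by auto
    then show ?thesis
      by (intro exI[of _ "\<lambda>m. u (monom_subst G m)"]) (auto simp: sum.reindex[OF True])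
  qed
  then obtain a where a: "\<exists>m\<in>?A. a m \<noteq> 0" "(\<Sum>m\<in>?A. poly_const (a m) * monom_subst G m) = 0"
    by blast
  let ?P = "\<Sum>m\<in>?A. Poly_Mapping.single m (a m)"
  have lk: "Poly_Mapping.lookup ?P m = (if m \<in> ?A then a m else 0)" for m
    using finA by (simp add: lookup_sum lookup_single when_def)
  have "m \<in> ?A" if "m \<in> Poly_Mapping.keys ?P" for m
    using that unfolding in_keys_iff lk by presburger
  then have "?P \<in> poly_ring d" unfolding poly_ring_def bounded_monomials_def by blast
  moreover have "?P \<noteq> 0" using a(1) lk by (metis lookup_zero)
  moreover have "poly_subst G ?P = 0" using a(2) by (simp add: poly_subst_sum poly_subst_single)
  ultimately show ?thesis by blast
qed

text \<open>Elements of the subalgebra are polynomials in the \<open>c\<close> generators. More than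
  \<open>c\<close> such polynomials satisfy a relation, which survives substituting the
  generators.\<close>

lemma trdeg_generated_le:
  fixes f :: "nat \<Rightarrow> 'k::field mvpoly"
  shows "trdeg (generated_subalgebra (f ` {..<c})) \<le> enat c"
  unfolding trdeg_def
proof (rule Sup_least, safe)
  fix d g
  assume g: "g ` {..<d} \<subseteq> generated_subalgebra (f ` {..<c})" and ind: "algebraically_independent d g"
  have "f ` {..<c} \<subseteq> poly_subst f ` poly_ring c"
    by (auto intro!: image_eqI[where x="poly_var _"])
  from generated_subalgebra_minimal[OF this closed_poly_subst_image]
  have "\<forall>i\<in>{..<d}. \<exists>G\<in>poly_ring c. g i = poly_subst f G" using g by blast
  then obtain G where G: "\<And>i. i < d \<Longrightarrow> G i \<in> poly_ring c" "\<And>i. i < d \<Longrightarrow> g i = poly_subst f (G i)"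
    by (metis lessThan_iff)
  show "enat d \<le> enat c"
  proof (rule ccontr)
    assume "\<not> enat d \<le> enat c"
    then have "c < d" by simp
    from exists_algebraic_relation[of d G c, OF G(1) this] obtain P where
      P: "P \<in> poly_ring d" "P \<noteq> 0" "poly_subst G P = 0" by blast
    have "poly_subst g P = poly_subst (\<lambda>i. poly_subst f (G i)) P"
      by (rule poly_subst_cong[OF P(1)]) (simp add: G(2))
    also have "\<dots> = 0" by (simp add: poly_subst_poly_subst[symmetric] P(3))
    finally show False using ind P unfolding algebraically_independent_def by blast
  qed
qed

lemma trdeg_ge: "f ` {..<d} \<subseteq> A \<Longrightarrow> algebraically_independent d f \<Longrightarrow> enat d \<le> trdeg A"
  unfolding trdeg_def by (rule Sup_upper) blast

section \<open>Functionals, derivations and the Poisson bracket\<close>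

locale nilpotent_lie_algebra = lie_algebra_with_basis scale bracket n x
  for scale :: "'k::field_char_0 \<Rightarrow> 'g::ab_group_add \<Rightarrow> 'g"
    and bracket :: "'g \<Rightarrow> 'g \<Rightarrow> 'g" and n :: nat and x :: "nat \<Rightarrow> 'g" +
  assumes is_nilpotent: nilpotent
begin

sublocale finite_dimensional_vector_space scale "x ` {..<n}"
  by unfold_locales (use basis_independent basis_span in auto)

lemma functional_pair: "vector_space_pair scale ((*) :: 'k \<Rightarrow> 'k \<Rightarrow> 'k)"
  by unfold_locales (auto simp: algebra_simps)

abbreviation sym :: "'g \<Rightarrow> 'k mvpoly" (\<open>\<sigma>\<close>) where "\<sigma> \<equiv> to_symmetric_algebra"

lemma dim_UNIV_eq: "dim UNIV = n"
  using basis_inj by (simp add: card_image)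

lemma dual_add: "\<xi> \<in> dual_space \<Longrightarrow> \<xi> (u + v) = \<xi> u + \<xi> v"
  and dual_scale: "\<xi> \<in> dual_space \<Longrightarrow> \<xi> (scale c v) = c * \<xi> v"
  and dual_0: "\<xi> \<in> dual_space \<Longrightarrow> \<xi> 0 = 0"
  and dual_minus: "\<xi> \<in> dual_space \<Longrightarrow> \<xi> (- v) = - \<xi> v"
  and dual_diff: "\<xi> \<in> dual_space \<Longrightarrow> \<xi> (u - v) = \<xi> u - \<xi> v"
  and dual_sum: "\<xi> \<in> dual_space \<Longrightarrow> \<xi> (sum h A) = (\<Sum>a\<in>A. \<xi> (h a))"
  unfolding dual_space_def
  by (simp_all add: functional_pair[THEN vector_space_pair.linear_add]
      functional_pair[THEN vector_space_pair.linear_scale]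
      functional_pair[THEN vector_space_pair.linear_0]
      functional_pair[THEN vector_space_pair.linear_neg]
      functional_pair[THEN vector_space_pair.linear_diff]
      functional_pair[THEN vector_space_pair.linear_sum])

lemmas dual_simps = dual_add dual_scale dual_0 dual_minus dual_diff

lemma dual_combination:
  assumes "\<xi> \<in> dual_space" "\<eta> \<in> dual_space"
  shows "(\<lambda>v. \<xi> v + t * \<eta> v) \<in> dual_space"
  using assms unfolding dual_space_def mem_Collect_eq
  by (intro functional_pair[THEN vector_space_pair.linear_compose_add]
      functional_pair[THEN vector_space_pair.linear_compose_scale_right])

lemma exists_functional:
  assumes "independent S"
  shows "\<exists>\<xi>\<in>dual_space. \<forall>v\<in>S. \<xi> v = h v"
  using vector_space_pair.linear_independent_extend[OF functional_pair assms, of h] unfolding dual_space_def by auto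

lemma exists_functional_subspace:
  assumes "subspace V" "v \<notin> V"
  shows "\<exists>\<xi>\<in>dual_space. \<xi> v = 1 \<and> (\<forall>u\<in>V. \<xi> u = 0)"
proof -
  obtain S where S: "S \<subseteq> V" "independent S" "V \<subseteq> span S"
    by (rule basis_exists[of V])
  have "span S = V" using S(1,3) assms(1) by (simp add: span_subspace)
  then have v: "v \<notin> span S" using assms(2) by simp
  then have "v \<notin> S" using span_base by blast
  have "independent (insert v S)" using S(2) v by (simp add: independent_insertI)
  from exists_functional[OF this, of "\<lambda>u. if u = v then 1 else 0"] obtain \<xi>
    where xi: "\<xi> \<in> dual_space" "\<forall>u\<in>insert v S. \<xi> u = (if u = v then 1 else 0)" by blast
  have "\<xi> u = 0" if "u \<in> span S" for u
    using that
  proof (induction rule: span_induct_alt)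
    case (step c a y)
    then have "\<xi> a = 0" using xi(2) \<open>v \<notin> S\<close> by auto
    then show ?case using step(2) by (simp add: dual_simps[OF xi(1)])
  qed (simp add: dual_0[OF xi(1)])
  then show ?thesis using xi \<open>span S = V\<close> by (intro bexI[of _ \<xi>]) auto
qed

lemma exists_functional_nonzero:
  assumes "v \<noteq> 0" obtains \<xi> where "\<xi> \<in> dual_space" "\<xi> v = 1"
  using exists_functional_subspace[of "{0}" v] assms by (auto simp: subspace_single_0)

lemma eq_0_if_functionals: "(\<And>\<xi>. \<xi> \<in> dual_space \<Longrightarrow> \<xi> v = 0) \<Longrightarrow> v = 0"
  using exists_functional_nonzero[of v] by (metis zero_neq_one)

lemma sym_add: "\<sigma> (u + v) = \<sigma> u + \<sigma> v"
  unfolding to_symmetric_algebra_def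
  by (simp add: representation_add[OF basis_independent] basis_span poly_const_add distrib_right
      sum.distrib)

lemma sym_scale: "\<sigma> (scale c v) = poly_const c * \<sigma> v"
  unfolding to_symmetric_algebra_def
  by (simp add: representation_scale[OF basis_independent] basis_span poly_const_mult
      sum_distrib_left mult.assoc)

lemma sym_0 [simp]: "\<sigma> 0 = 0"
  using sym_scale[of 0 0] by simp

lemma sym_minus: "\<sigma> (- v) = - \<sigma> v"
  using sym_add[of v "- v"] by (simp add: eq_neg_iff_add_eq_0 add.commute)

lemma sym_diff: "\<sigma> (u - v) = \<sigma> u - \<sigma> v"
  using sym_add[of u "- v"] by (simp add: sym_minus)

lemma sym_sum: "\<sigma> (sum h A) = (\<Sum>a\<in>A. \<sigma> (h a))"
  by (induction A rule: infinite_finite_induct) (auto simp: sym_add)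

lemmas sym_simps = sym_add sym_scale sym_minus sym_diff

lemma sym_in_poly_ring: "\<sigma> v \<in> poly_ring n"
  unfolding to_symmetric_algebra_def by (intro poly_ring_sum poly_ring_mult) auto

lemma total_degree_sym: "total_degree (\<sigma> v) \<le> 1"
  unfolding to_symmetric_algebra_def
  by (intro total_degree_sum_le)
     (use total_degree_mult_le[of "poly_const _" 0 "poly_var _" 1] in \<open>simp add: total_degree_const total_degree_var[unfolded One_nat_def]\<close>)

abbreviation coord :: "nat \<Rightarrow> 'g \<Rightarrow> 'k" where
  "coord i v \<equiv> representation (x ` {..<n}) v (x i)"

lemma sum_coord: "(\<Sum>i<n. scale (coord i v) (x i)) = v"
proof -
  have "(\<Sum>b\<in>x ` {..<n}. scale (representation (x ` {..<n}) v b) b) = v"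
    by (rule sum_representation_eq[OF basis_independent]) (auto simp: basis_span)
  then show ?thesis by (simp add: sum.reindex[OF basis_inj])
qed

lemma partial_deriv_sym: "i < n \<Longrightarrow> partial_deriv i (\<sigma> v) = poly_const (coord i v)"
proof -
  assume i: "i < n"
  have sum: "partial_deriv i (sum h A) = (\<Sum>a\<in>A. partial_deriv i (h a))"
    for h :: "nat \<Rightarrow> 'k mvpoly" and A
    by (induction A rule: infinite_finite_induct) (auto simp: partial_deriv_add partial_deriv_def[of _ 0])
  show ?thesis
    unfolding to_symmetric_algebra_def using i
    by (simp add: sum partial_deriv_mult partial_deriv_var if_distrib[of "\<lambda>x. _ * x"] cong: if_cong)
qed

text \<open>Regarding S(g) as the polynomial functions on the dual space, this is the derivative in
  the constant direction xi.\<close>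

definition dir_deriv :: "('g \<Rightarrow> 'k) \<Rightarrow> 'k mvpoly \<Rightarrow> 'k mvpoly" where
  "dir_deriv \<xi> p = (\<Sum>i<n. poly_const (\<xi> (x i)) * partial_deriv i p)"

lemma is_derivation_sum_partial_deriv: "is_derivation (\<lambda>p. \<Sum>i\<in>A. c i * partial_deriv i p)"
  unfolding is_derivation_def
  by (simp add: partial_deriv_add partial_deriv_mult algebra_simps sum.distrib sum_distrib_left
      sum_distrib_right)

lemma is_derivation_dir_deriv: "is_derivation (dir_deriv \<xi>)"
  unfolding dir_deriv_def[abs_def] by (rule is_derivation_sum_partial_deriv)

lemma derivation_simps:
  assumes "is_derivation D"
  shows "D (p + q) = D p + D q" "D (p * q) = D p * q + p * D q" "D (poly_const c) = 0"
    "D 0 = 0" "D (- p) = - D p" "D (p - q) = D p - D q"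
proof -
  note d = assms[unfolded is_derivation_def]
  show 1: "D (p + q) = D p + D q" for p q using d by blast
  show "D (p * q) = D p * q + p * D q" "D (poly_const c) = 0" using d by blast+
  show 0: "D 0 = 0" by (rule derivation_0[OF assms])
  show m: "D (- p) = - D p" for p using 1[of p "- p"] 0 by (simp add: eq_neg_iff_add_eq_0 add.commute)
  show "D (p - q) = D p - D q" using 1[of p "- q"] m[of q] by simp
qed

lemmas dir_deriv_simps = derivation_simps[OF is_derivation_dir_deriv]

lemma dir_deriv_sym: "\<xi> \<in> dual_space \<Longrightarrow> dir_deriv \<xi> (\<sigma> v) = poly_const (\<xi> v)"
proof -
  assume xi: "\<xi> \<in> dual_space"
  have "dir_deriv \<xi> (\<sigma> v) = (\<Sum>i<n. poly_const (\<xi> (scale (coord i v) (x i))))"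
    unfolding dir_deriv_def
    by (simp add: partial_deriv_sym poly_const_mult[symmetric] dual_scale[OF xi] mult.commute)
  also have "\<dots> = poly_const (\<xi> (\<Sum>i<n. scale (coord i v) (x i)))"
  proof -
    have "poly_const (sum h A) = (\<Sum>a\<in>A. poly_const (h a))" for h :: "nat \<Rightarrow> 'k" and A
      by (induction A rule: infinite_finite_induct) (auto simp: poly_const_add)
    then show ?thesis by (simp add: dual_sum[OF xi])
  qed
  finally show ?thesis by (simp add: sum_coord)
qed

lemma sym_eq_0_iff [simp]: "\<sigma> v = 0 \<longleftrightarrow> v = 0"
proof
  assume "\<sigma> v = 0"
  then show "v = 0"
    using dir_deriv_sym[of _ v] by (intro eq_0_if_functionals) (metis dir_deriv_simps(4) poly_const_eq_0_iff)
qed simp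

text \<open>A quadratic form that vanishes at every point of the dual space is the zero polynomial:
  polarisation kills its directional derivatives, and Euler's identity recovers twice the form from
  them.\<close>

lemma sum_sym_products_eq_0:
  assumes I: "finite I"
    and vanish: "\<And>\<xi>. \<xi> \<in> dual_space \<Longrightarrow> (\<Sum>i\<in>I. \<xi> (u i) * \<xi> (v i)) = 0"
  shows "(\<Sum>i\<in>I. \<sigma> (u i) * \<sigma> (v i)) = 0"
proof -
  let ?q = "\<Sum>i\<in>I. \<sigma> (u i) * \<sigma> (v i)"
  have sum_D: "D (sum h I) = (\<Sum>a\<in>I. D (h a))" if "is_derivation D" for D :: "'k mvpoly \<Rightarrow> 'k mvpoly" and h
    using I by (induction I rule: finite_induct) (auto simp: derivation_simps[OF that])
  have zero: "dir_deriv \<eta> ?q = 0" if eta: "\<eta> \<in> dual_space" for \<eta>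
  proof -
    let ?w = "\<Sum>i\<in>I. scale (\<eta> (u i)) (v i) + scale (\<eta> (v i)) (u i)"
    have "?w = 0"
    proof (rule eq_0_if_functionals)
      fix \<xi> assume xi: "\<xi> \<in> dual_space"
      \<comment> \<open>Polarisation: the value at xi + eta minus those at xi and eta is the mixed
        term.\<close>
      have "(\<Sum>i\<in>I. (\<xi> (u i) + 1 * \<eta> (u i)) * (\<xi> (v i) + 1 * \<eta> (v i))) = 0"
        by (rule vanish[OF dual_combination[OF xi eta]])
      then have "(\<Sum>i\<in>I. \<eta> (u i) * \<xi> (v i) + \<eta> (v i) * \<xi> (u i))
          + (\<Sum>i\<in>I. \<xi> (u i) * \<xi> (v i)) + (\<Sum>i\<in>I. \<eta> (u i) * \<eta> (v i)) = 0"
        by (simp add: sum.distrib[symmetric] algebra_simps)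
      then show "\<xi> ?w = 0"
        by (simp add: dual_sum[OF xi] dual_simps[OF xi] vanish xi eta)
    qed
    have "dir_deriv \<eta> ?q = \<sigma> ?w"
      by (simp add: sum_D[OF is_derivation_dir_deriv] dir_deriv_simps dir_deriv_sym[OF eta]
          sym_sum sym_simps algebra_simps)
    then show ?thesis by (simp add: \<open>?w = 0\<close>)
  qed
  have partial: "partial_deriv i ?q = 0" if i: "i < n" for i
  proof -
    \<comment> \<open>In the direction dual to \<open>x i\<close>, \<open>dir_deriv\<close> is the
      partial derivative.\<close>
    obtain \<eta> where eta: "\<eta> \<in> dual_space" "\<And>b. b \<in> x ` {..<n} \<Longrightarrow> \<eta> b = (if b = x i then 1 else 0)"
      using exists_functional[OF basis_independent, of "\<lambda>b. if b = x i then 1 else 0"] by auto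
    have "x j = x i \<longleftrightarrow> j = i" if "j < n" for j
      using basis_inj i that by (auto simp: inj_on_def)
    then have "dir_deriv \<eta> ?q = (\<Sum>j<n. if j = i then partial_deriv j ?q else 0)"
      unfolding dir_deriv_def using eta(2) by (intro sum.cong) auto
    then show ?thesis using zero[OF eta(1)] i by simp
  qed
  txt \<open>The Euler derivation multiplies the quadratic form \<open>?q\<close> by 2.\<close>
  let ?E = "\<lambda>p. \<Sum>i<n. poly_var i * partial_deriv i p"
  have E: "is_derivation ?E" by (rule is_derivation_sum_partial_deriv)
  have E_sym: "?E (\<sigma> w) = \<sigma> w" for w
  proof -
    have "?E (\<sigma> w) = (\<Sum>i<n. poly_const (coord i w) * poly_var i)"
      by (intro sum.cong) (auto simp: partial_deriv_sym mult.commute)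
    then show ?thesis by (simp add: to_symmetric_algebra_def)
  qed
  have "?E ?q = (\<Sum>i\<in>I. \<sigma> (u i) * \<sigma> (v i) + \<sigma> (u i) * \<sigma> (v i))"
    unfolding sum_D[OF E] derivation_simps(2)[OF E] E_sym ..
  also have "\<dots> = poly_const 2 * ?q"
  proof -
    have "poly_const 2 = (2 :: 'k mvpoly)" using poly_const_add[of "1::'k" 1] by simp
    then show ?thesis by (simp only: sum_distrib_left mult_2)
  qed
  finally have "poly_const 2 * ?q = 0" using partial by simp
  then show ?thesis by simp
qed

section \<open>The Poisson bracket as a biderivation\<close>

lemma poisson_bracket_right: "is_derivation (poisson_bracket p)"
  unfolding is_derivation_def poisson_bracket_def
  by (simp add: partial_deriv_add partial_deriv_mult algebra_simps sum.distrib sum_distrib_left)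

lemma bracket_0_left [simp]: "bracket 0 v = 0" and bracket_0_right [simp]: "bracket v 0 = 0"
  using bracket_scale_left[of 0 0 v] bracket_scale_right[of v 0 0] by simp_all

lemma bracket_minus_left: "bracket (- u) v = - bracket u v"
  and bracket_minus_right: "bracket u (- v) = - bracket u v"
  using bracket_scale_left[of "-1" u v] bracket_scale_right[of u "-1" v] by simp_all

lemma bracket_diff_left: "bracket (u - w) v = bracket u v - bracket w v"
  and bracket_diff_right: "bracket v (u - w) = bracket v u - bracket v w"
  using bracket_add_left[of u "- w" v] bracket_add_right[of v u "- w"]
  by (simp_all add: bracket_minus_left bracket_minus_right)

lemma bracket_skew: "bracket u v = - bracket v u"
proof -
  have "bracket u v + bracket v u = 0"
    using bracket_self[of "u + v"] unfolding bracket_add_left bracket_add_right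
    by (simp add: bracket_self add.commute)
  then show ?thesis by (simp only: eq_neg_iff_add_eq_0)
qed

lemma bracket_sum_left: "bracket (sum h A) v = (\<Sum>a\<in>A. bracket (h a) v)"
  and bracket_sum_right: "bracket v (sum h A) = (\<Sum>a\<in>A. bracket v (h a))"
  by (induction A rule: infinite_finite_induct) (auto simp: bracket_add_left bracket_add_right)

lemmas bracket_simps = bracket_add_left bracket_add_right bracket_scale_left bracket_scale_right
  bracket_minus_left bracket_minus_right bracket_diff_left bracket_diff_right bracket_self

lemma poisson_bracket_skew: "poisson_bracket p q = - poisson_bracket q p"
proof -
  have "poisson_bracket p q
      = (\<Sum>j<n. \<Sum>i<n. \<sigma> (bracket (x i) (x j)) * partial_deriv i p * partial_deriv j q)"
    unfolding poisson_bracket_def by (rule sum.swap)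
  also have "\<dots> = (\<Sum>j<n. \<Sum>i<n. - (\<sigma> (bracket (x j) (x i)) * partial_deriv j q * partial_deriv i p))"
    by (intro sum.cong refl, subst bracket_skew) (simp add: sym_minus mult_ac)
  finally show ?thesis by (simp add: poisson_bracket_def sum_negf)
qed

lemma poisson_bracket_sym: "poisson_bracket (\<sigma> u) (\<sigma> v) = \<sigma> (bracket u v)"
proof -
  have "\<sigma> (bracket u v) = \<sigma> (bracket (\<Sum>i<n. scale (coord i u) (x i)) (\<Sum>j<n. scale (coord j v) (x j)))"
    by (simp add: sum_coord)
  also have "\<dots> = (\<Sum>i<n. \<Sum>j<n. \<sigma> (bracket (x i) (x j)) * poly_const (coord i u) * poly_const (coord j v))"
    by (simp add: bracket_sum_left bracket_sum_right bracket_scale_left bracket_scale_right sym_sum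
        sym_scale mult_ac sum_distrib_left) (rule sum.swap)
  also have "\<dots> = poisson_bracket (\<sigma> u) (\<sigma> v)"
    unfolding poisson_bracket_def by (intro sum.cong) (auto simp: partial_deriv_sym)
  finally show ?thesis by simp
qed

lemma poisson_bracket_left: "is_derivation (\<lambda>p. poisson_bracket p q)"
  using poisson_bracket_right[of q] unfolding is_derivation_def
  by (simp add: poisson_bracket_skew[of _ q])

lemmas poisson_simps = derivation_simps[OF poisson_bracket_left] derivation_simps[OF poisson_bracket_right]
  poisson_bracket_sym

section \<open>Symplectic systems and Pfaffians\<close>


text \<open>A chain of \<open>s\<close> mutually orthogonal hyperbolic planes (without normalising
  the pairs): it witnesses that B_xi has rank at least 2s on \<open>V\<close>. Stated recursively,
  one plane can be prepended or split off at a time.\<close>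

fun symplectic_system :: "('g \<Rightarrow> 'k) \<Rightarrow> nat \<Rightarrow> 'g set \<Rightarrow> bool" where
  "symplectic_system \<xi> 0 V = True"
| "symplectic_system \<xi> (Suc s) V = (\<exists>e\<in>V. \<exists>f\<in>V. \<xi> (bracket e f) \<noteq> 0 \<and>
     symplectic_system \<xi> s {v \<in> V. \<xi> (bracket e v) = 0 \<and> \<xi> (bracket f v) = 0})"

lemma dual_bracket: "\<xi> \<in> dual_space \<Longrightarrow> (\<lambda>v. \<xi> (bracket y v)) \<in> dual_space"
proof -
  assume xi: "\<xi> \<in> dual_space"
  have "Vector_Spaces.linear scale scale (bracket y)"
    unfolding Vector_Spaces.linear_iff
    by (intro conjI allI vector_space_axioms) (simp_all add: bracket_simps)
  then have "Vector_Spaces.linear scale (*) (\<xi> \<circ> bracket y)"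
    using xi unfolding dual_space_def by (intro Vector_Spaces.linear_compose) auto
  then show ?thesis by (simp add: dual_space_def comp_def)
qed

lemma subspace_kernel: "\<xi> \<in> dual_space \<Longrightarrow> subspace V \<Longrightarrow> subspace {v \<in> V. \<xi> v = 0}"
  unfolding subspace_def by (simp add: dual_simps)

lemma dual_skew: "\<xi> \<in> dual_space \<Longrightarrow> \<xi> (bracket u v) = - \<xi> (bracket v u)"
  by (subst bracket_skew) (simp add: dual_minus)

lemma subspace_perp:
  assumes "\<xi> \<in> dual_space" "subspace V"
  shows "subspace {v \<in> V. \<xi> (bracket e v) = 0 \<and> \<xi> (bracket f v) = 0}"
proof -
  have "{v \<in> V. \<xi> (bracket e v) = 0 \<and> \<xi> (bracket f v) = 0}
      = {v \<in> {v \<in> V. \<xi> (bracket e v) = 0}. \<xi> (bracket f v) = 0}" by auto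
  then show ?thesis
    using subspace_kernel[OF dual_bracket[OF assms(1), of f]
        subspace_kernel[OF dual_bracket[OF assms(1), of e] assms(2)]] by simp
qed

lemma dim_insert_notin: "subspace V \<Longrightarrow> v \<notin> V \<Longrightarrow> dim (insert v V) = Suc (dim V)"
  by (simp add: dim_insert span_eq_iff[THEN iffD2])

lemma dim_perp_le:
  assumes xi: "\<xi> \<in> dual_space" and V: "subspace V" and ef: "e \<in> V" "f \<in> V" "\<xi> (bracket e f) \<noteq> 0"
  shows "dim {v \<in> V. \<xi> (bracket e v) = 0 \<and> \<xi> (bracket f v) = 0} + 2 \<le> dim V" (is "dim ?W + 2 \<le> _")
proof -
  have W: "subspace ?W" by (rule subspace_perp[OF xi V])
  have "e \<notin> ?W" using ef(3) dual_skew[OF xi, of e f] by auto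
  have "f \<notin> span (insert e ?W)"
  proof
    assume "f \<in> span (insert e ?W)"
    then obtain k where "f - scale k e \<in> span ?W" by (auto simp: span_breakdown_eq)
    then have "f - scale k e \<in> ?W" using span_eq_iff[THEN iffD2, OF W] by simp
    then show False using ef(3) by (simp add: bracket_simps dual_simps[OF xi])
  qed
  then have "dim (insert f (insert e ?W)) = dim ?W + 2"
    using dim_insert_notin[OF W \<open>e \<notin> ?W\<close>] by (simp add: dim_insert)
  moreover have "dim (insert f (insert e ?W)) \<le> dim V"
    using ef by (intro dim_subset) auto
  ultimately show ?thesis by simp
qed

text \<open>Each plane costs two dimensions, while \<open>U\<close>, being orthogonal to all of
  \<open>V\<close>, survives in every successive complement.\<close>

lemma symplectic_system_dim:
  assumes xi: "\<xi> \<in> dual_space" and "subspace V" "U \<subseteq> V"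
    and "\<And>u v. u \<in> U \<Longrightarrow> v \<in> V \<Longrightarrow> \<xi> (bracket v u) = 0" and "symplectic_system \<xi> s V"
  shows "2 * s + dim U \<le> dim V"
  using assms(2-)
proof (induction s arbitrary: V)
  case 0
  then show ?case by (simp add: dim_subset)
next
  case (Suc s)
  then obtain e f where ef: "e \<in> V" "f \<in> V" "\<xi> (bracket e f) \<noteq> 0"
    and sys: "symplectic_system \<xi> s {v \<in> V. \<xi> (bracket e v) = 0 \<and> \<xi> (bracket f v) = 0}" by auto
  have "2 * s + dim U \<le> dim {v \<in> V. \<xi> (bracket e v) = 0 \<and> \<xi> (bracket f v) = 0}"
    using Suc.prems ef by (intro Suc.IH[OF subspace_perp[OF xi Suc.prems(1)] _ _ sys]) auto
  then show ?case using dim_perp_le[OF xi Suc.prems(1) ef] by simp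
qed

text \<open>The symplectic Gram-Schmidt step: projection to the orthogonal complement along the
  plane of \<open>e\<close> and \<open>f\<close>.\<close>

lemma perp_decomposition:
  assumes xi: "\<xi> \<in> dual_space" and V: "subspace V" and ef: "e \<in> V" "f \<in> V" "\<xi> (bracket e f) \<noteq> 0"
    and v: "v \<in> V"
  shows "v - scale (\<xi> (bracket v f) / \<xi> (bracket e f)) e - scale (\<xi> (bracket e v) / \<xi> (bracket e f)) f
    \<in> {v \<in> V. \<xi> (bracket e v) = 0 \<and> \<xi> (bracket f v) = 0}"
  using ef v V dual_skew[OF xi, of f v] dual_skew[OF xi, of f e]
  by (auto simp: bracket_simps dual_simps[OF xi] intro!: subspace_diff subspace_scale)

text \<open>Hyperbolic planes are split off as long as the form is nonzero. \<open>V\<close> is the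
  sum of the plane and its complement, so the radical of the complement is the radical of
  \<open>V\<close>, and what remains in the end is that radical.\<close>

lemma exists_symplectic_system:
  assumes xi: "\<xi> \<in> dual_space" and "subspace V"
  shows "\<exists>s. symplectic_system \<xi> s V \<and> dim V = 2 * s + dim {u \<in> V. \<forall>v\<in>V. \<xi> (bracket u v) = 0}"
  using assms(2)
proof (induction "dim V" arbitrary: V rule: less_induct)
  case less
  show ?case
  proof (cases "\<exists>e\<in>V. \<exists>f\<in>V. \<xi> (bracket e f) \<noteq> 0")
    case False
    then have "{u \<in> V. \<forall>v\<in>V. \<xi> (bracket u v) = 0} = V" by auto
    then show ?thesis by (intro exI[of _ 0]) simp
  next
    case True
    then obtain e f where ef: "e \<in> V" "f \<in> V" "\<xi> (bracket e f) \<noteq> 0" by blast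
    let ?W = "{v \<in> V. \<xi> (bracket e v) = 0 \<and> \<xi> (bracket f v) = 0}"
    have W: "subspace ?W" by (rule subspace_perp[OF xi less.prems])
    note le = dim_perp_le[OF xi less.prems ef]
    obtain s where s: "symplectic_system \<xi> s ?W"
      "dim ?W = 2 * s + dim {u \<in> ?W. \<forall>v\<in>?W. \<xi> (bracket u v) = 0}"
      using less.hyps[OF _ W] le by auto
    have decomp: "\<exists>a b w. v = w + scale a e + scale b f \<and> w \<in> ?W" if v: "v \<in> V" for v
      by (rule exI[of _ "\<xi> (bracket v f) / \<xi> (bracket e f)"],
          rule exI[of _ "\<xi> (bracket e v) / \<xi> (bracket e f)"], rule exI,
          rule conjI[rotated], rule perp_decomposition[OF xi less.prems ef v]) simp
    have "V \<subseteq> span (insert f (insert e ?W))"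
    proof
      fix v assume "v \<in> V"
      then obtain a b w where "v = w + scale a e + scale b f" "w \<in> ?W" using decomp by blast
      moreover have "w + scale a e + scale b f \<in> span (insert f (insert e ?W))"
        using \<open>w \<in> ?W\<close> by (intro span_add span_scale span_base insertI2[of w]) auto
      ultimately show "v \<in> span (insert f (insert e ?W))" by simp
    qed
    then have "dim V \<le> dim (insert f (insert e ?W))" by (rule dim_mono)
    also have "\<dots> \<le> dim ?W + 2" by (simp add: dim_insert)
    finally have dimV: "dim V = dim ?W + 2" using le by simp
    have "{u \<in> ?W. \<forall>v\<in>?W. \<xi> (bracket u v) = 0} = {u \<in> V. \<forall>v\<in>V. \<xi> (bracket u v) = 0}"
    proof (intro equalityI subsetI)
      fix u assume u: "u \<in> {u \<in> ?W. \<forall>v\<in>?W. \<xi> (bracket u v) = 0}"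
      have "\<xi> (bracket u v) = 0" if v: "v \<in> V" for v
      proof -
        obtain a b w where w: "v = w + scale a e + scale b f" "w \<in> ?W" using decomp[OF v] by blast
        have "\<xi> (bracket u e) = 0" "\<xi> (bracket u f) = 0" "\<xi> (bracket u w) = 0"
          using u w(2) dual_skew[OF xi, of u e] dual_skew[OF xi, of u f] by auto
        then show ?thesis by (simp add: w(1) bracket_simps dual_simps[OF xi])
      qed
      then show "u \<in> {u \<in> V. \<forall>v\<in>V. \<xi> (bracket u v) = 0}" using u by auto
    next
      fix u assume "u \<in> {u \<in> V. \<forall>v\<in>V. \<xi> (bracket u v) = 0}"
      then show "u \<in> {u \<in> ?W. \<forall>v\<in>?W. \<xi> (bracket u v) = 0}"
        using ef dual_skew[OF xi, of e u] dual_skew[OF xi, of f u] by auto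
    qed
    then show ?thesis using s dimV ef by (intro exI[of _ "Suc s"]) auto
  qed
qed

section \<open>Pfaffians as a test for rank four\<close>

definition pfaffian :: "('g \<Rightarrow> 'k) \<Rightarrow> 'g \<Rightarrow> 'g \<Rightarrow> 'g \<Rightarrow> 'g \<Rightarrow> 'k" where
  "pfaffian \<xi> a b c d = \<xi> (bracket a b) * \<xi> (bracket c d) - \<xi> (bracket a c) * \<xi> (bracket b d)
     + \<xi> (bracket a d) * \<xi> (bracket b c)"

text \<open>If B_xi(a,b) is nonzero, projecting \<open>c\<close> and \<open>d\<close> off the plane
  of \<open>a\<close> and \<open>b\<close> gives vectors whose pairing, times B_xi(a,b), is the
  Pfaffian. Otherwise \<open>a\<close> pairs nontrivially with \<open>c\<close> or \<open>d\<close>,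
  and permuting the arguments changes the Pfaffian at most by a sign.\<close>

lemma symplectic_system_2_if_pfaffian:
  assumes xi: "\<xi> \<in> dual_space" and V: "subspace V"
    and abcd: "a \<in> V" "b \<in> V" "c \<in> V" "d \<in> V" and pf: "pfaffian \<xi> a b c d \<noteq> 0"
  shows "symplectic_system \<xi> 2 V"
proof -
  have main: "symplectic_system \<xi> 2 V"
    if abcd: "a \<in> V" "b \<in> V" "c \<in> V" "d \<in> V" and pf: "pfaffian \<xi> a b c d \<noteq> 0"
      and ab: "\<xi> (bracket a b) \<noteq> 0" for a b c d
  proof -
    let ?c = "c - scale (\<xi> (bracket c b) / \<xi> (bracket a b)) a - scale (\<xi> (bracket a c) / \<xi> (bracket a b)) b"
    let ?d = "d - scale (\<xi> (bracket d b) / \<xi> (bracket a b)) a - scale (\<xi> (bracket a d) / \<xi> (bracket a b)) b"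
    let ?W = "{v \<in> V. \<xi> (bracket a v) = 0 \<and> \<xi> (bracket b v) = 0}"
    have W: "?c \<in> ?W" "?d \<in> ?W" using perp_decomposition[OF xi V abcd(1,2) ab] abcd by blast+
    have "\<xi> (bracket ?c a) = 0" "\<xi> (bracket ?c b) = 0"
      using W(1) dual_skew[OF xi, of ?c a] dual_skew[OF xi, of ?c b] by auto
    then have "\<xi> (bracket ?c ?d) = \<xi> (bracket ?c d)"
      by (simp only: bracket_diff_right[of ?c] bracket_scale_right[of ?c] dual_simps[OF xi]) simp
    also have "\<dots> * \<xi> (bracket a b) = pfaffian \<xi> a b c d"
      using ab dual_skew[OF xi, of c b]
      by (simp add: bracket_simps dual_simps[OF xi] pfaffian_def field_simps)
    finally have "\<xi> (bracket ?c ?d) * \<xi> (bracket a b) = pfaffian \<xi> a b c d" .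
    then have "\<xi> (bracket ?c ?d) \<noteq> 0" using pf by auto
    then have "symplectic_system \<xi> 1 ?W" using W by (simp only: One_nat_def symplectic_system.simps) blast
    then show ?thesis using abcd(1,2) ab
      by (simp only: numeral_2_eq_2 One_nat_def symplectic_system.simps(2)[of \<xi> "Suc 0" V]) blast
  qed
  have "\<xi> (bracket a b) \<noteq> 0 \<or> \<xi> (bracket a c) \<noteq> 0 \<or> \<xi> (bracket a d) \<noteq> 0"
    using pf by (auto simp: pfaffian_def)
  moreover have "pfaffian \<xi> a c b d = - pfaffian \<xi> a b c d" "pfaffian \<xi> a d b c = pfaffian \<xi> a b c d"
    using dual_skew[OF xi, of c b] dual_skew[OF xi, of d b] dual_skew[OF xi, of d c]
    by (simp_all add: pfaffian_def)
  ultimately show ?thesis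
    using main[OF abcd pf] main[of a c b d] main[of a d b c] abcd pf by auto
qed

text \<open>Every B_xi has rank at most two on \<open>h\<close>, phrased through equations quadratic
  in xi so that it can be transferred to S(g).\<close>

definition pfaffians_vanish :: "'g set \<Rightarrow> bool" where
  "pfaffians_vanish h \<longleftrightarrow>
     (\<forall>\<xi>\<in>dual_space. \<forall>a\<in>h. \<forall>b\<in>h. \<forall>c\<in>h. \<forall>d\<in>h. pfaffian \<xi> a b c d = 0)"

lemma pfaffians_vanish_if_no_system:
  assumes "subspace h" "\<And>\<xi>. \<xi> \<in> dual_space \<Longrightarrow> \<not> symplectic_system \<xi> 2 h"
  shows "pfaffians_vanish h"
  unfolding pfaffians_vanish_def using symplectic_system_2_if_pfaffian[OF _ assms(1)] assms(2) by blast

section \<open>Subalgebras\<close>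

definition lie_subalgebra :: "'g set \<Rightarrow> bool" where
  "lie_subalgebra h \<longleftrightarrow> subspace h \<and> (\<forall>u\<in>h. \<forall>v\<in>h. bracket u v \<in> h)"

definition center :: "'g set \<Rightarrow> 'g set" where
  "center h = {z \<in> h. \<forall>v\<in>h. bracket z v = 0}"

lemma subspace_center: "subspace h \<Longrightarrow> subspace (center h)"
  unfolding center_def subspace_def by (simp add: bracket_simps)

lemma center_commute: "z \<in> center h \<Longrightarrow> v \<in> h \<Longrightarrow> bracket z v = 0 \<and> bracket v z = 0"
  using bracket_skew[of v z] by (simp add: center_def)

text \<open>If every noncentral element of \<open>h\<close> had a noncentral bracket with some
  element of \<open>h\<close>, iterating would put noncentral elements into every term of the lower
  central series, even the zero one.\<close>

lemma exists_second_center: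
  assumes h: "lie_subalgebra h" and v: "v \<in> h" "v \<notin> center h"
  shows "\<exists>y\<in>h. y \<notin> center h \<and> (\<forall>u\<in>h. bracket u y \<in> center h)"
proof (rule ccontr)
  assume no: "\<not> ?thesis"
  have noncentral: "\<exists>v\<in>h. v \<notin> center h \<and> v \<in> lower_central_series k" for k
  proof (induction k)
    case 0
    then show ?case using v by auto
  next
    case (Suc k)
    then obtain v where v: "v \<in> h" "v \<notin> center h" "v \<in> lower_central_series k" by blast
    then obtain u where u: "u \<in> h" "bracket u v \<notin> center h" using no by blast
    have "bracket u v \<in> lower_central_series (Suc k)"
      using v(3) by (auto intro!: span_base)
    moreover have "bracket u v \<in> h" using h u(1) v(1) by (simp add: lie_subalgebra_def)
    ultimately show ?case using u(2) by blast
  qed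
  obtain j where "lower_central_series j = {0}" using is_nilpotent nilpotent_def by blast
  moreover have "0 \<in> center h" using subspace_center h lie_subalgebra_def subspace_0 by blast
  ultimately show False using noncentral[of j] by auto
qed

text \<open>For nonzero \<open>c\<close>, \<open>w\<close> is a multiple of its own bracket with
  \<open>u\<close> and so never leaves the lower central series.\<close>

lemma bracket_eigenvalue:
  assumes "bracket u w = scale c w"
  shows "bracket u w = 0"
proof (cases "c = 0")
  case False
  have w: "w \<in> lower_central_series k" for k
  proof (induction k)
    case (Suc k)
    then have "scale (1 / c) (bracket u w) \<in> lower_central_series (Suc k)"
      unfolding lower_central_series.simps by (intro span_scale span_base) blast
    then show ?case using assms False by simp
  qed simp
  obtain j where "lower_central_series j = {0}" using is_nilpotent nilpotent_def by blast
  then show ?thesis using w[of j] by simp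
qed (simp add: assms)

lemma dim_kernel:
  assumes xi: "\<xi> \<in> dual_space" and V: "subspace V" and v: "v \<in> V" "\<xi> v \<noteq> 0"
  shows "dim V = Suc (dim {u \<in> V. \<xi> u = 0})"
proof -
  let ?K = "{u \<in> V. \<xi> u = 0}"
  have K: "subspace ?K" by (rule subspace_kernel[OF xi V])
  have "V \<subseteq> span (insert v ?K)"
  proof
    fix u assume "u \<in> V"
    then have "u - scale (\<xi> u / \<xi> v) v \<in> ?K"
      using v V by (auto simp: dual_simps[OF xi] intro!: subspace_diff subspace_scale)
    then show "u \<in> span (insert v ?K)"
      unfolding span_breakdown_eq by (intro exI[of _ "\<xi> u / \<xi> v"] span_base)
  qed
  then have "dim V \<le> dim (insert v ?K)" by (rule dim_mono)
  moreover have "dim (insert v ?K) \<le> dim V" using v by (intro dim_subset) auto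
  moreover have "dim (insert v ?K) = Suc (dim ?K)" by (rule dim_insert_notin[OF K]) (use v in auto)
  ultimately show ?thesis by simp
qed

text \<open>The rank is at most dim h - dim U <= 3, and four is the next even rank after
  two.\<close>

lemma pfaffians_vanish_if_small:
  assumes h: "subspace h" and U: "U \<subseteq> h" "\<And>u v. u \<in> U \<Longrightarrow> v \<in> h \<Longrightarrow> bracket v u = 0"
    and dim: "dim h \<le> dim U + 3"
  shows "pfaffians_vanish h"
proof (rule pfaffians_vanish_if_no_system[OF h], rule notI)
  fix \<xi> assume xi: "\<xi> \<in> dual_space" and sys: "symplectic_system \<xi> 2 h"
  have "2 * 2 + dim U \<le> dim h"
    by (rule symplectic_system_dim[OF xi h U(1) _ sys]) (simp add: U(2) dual_0[OF xi])
  then show False using dim by simp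
qed

text \<open>Along the line xi + t eta the Pfaffian is a polynomial in t of degree at most two with
  nonzero constant term, so it cannot vanish at all of t = 1, -1, 2; and any t other than 0 makes
  the value at \<open>z\<close> nonzero.\<close>

lemma pfaffian_perturb:
  assumes xi: "\<xi> \<in> dual_space" and eta: "\<eta> \<in> dual_space" and z: "\<eta> z \<noteq> 0" and pf: "pfaffian \<xi> a b c d \<noteq> 0"
  shows "\<exists>\<zeta>\<in>dual_space. \<zeta> z \<noteq> 0 \<and> pfaffian \<zeta> a b c d \<noteq> 0"
proof (cases "\<xi> z = 0")
  case True
  define A where "A = pfaffian \<xi> a b c d"
  define C where "C = pfaffian \<eta> a b c d"
  define B where "B = \<xi> (bracket a b) * \<eta> (bracket c d) + \<eta> (bracket a b) * \<xi> (bracket c d)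
    - \<xi> (bracket a c) * \<eta> (bracket b d) - \<eta> (bracket a c) * \<xi> (bracket b d)
    + \<xi> (bracket a d) * \<eta> (bracket b c) + \<eta> (bracket a d) * \<xi> (bracket b c)"
  have pf_t: "pfaffian (\<lambda>v. \<xi> v + t * \<eta> v) a b c d = A + t * B + t * t * C" for t
    unfolding A_def B_def C_def pfaffian_def by algebra
  have "\<exists>t. t \<noteq> 0 \<and> A + t * B + t * t * C \<noteq> 0"
  proof (rule ccontr)
    assume "\<not> ?thesis"
    then have t: "\<And>t. t \<noteq> 0 \<Longrightarrow> A + t * B + t * t * C = 0" by blast
    have "A + B + C = 0" "A - B + C = 0" "A + 2 * B + 4 * C = 0"
      using t[of 1] t[of "-1"] t[of 2] by simp_all
    moreover have "3 * A = 3 * (A + B + C) + (A - B + C) - (A + 2 * B + 4 * C)"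
      by (simp add: algebra_simps)
    ultimately have "3 * A = 0" by simp
    then show False using pf A_def by simp
  qed
  then obtain t where "t \<noteq> 0" "A + t * B + t * t * C \<noteq> 0" by blast
  then show ?thesis
    using dual_combination[OF xi eta, of t] pf_t[of t] True z by (intro bexI) auto
qed (use xi pf in auto)

text \<open>Suppose some form has rank four on the centralizer of \<open>y\<close>. After a
  perturbation it is also nonzero on \<open>bracket y v\<close>, so \<open>y\<close> and
  \<open>v\<close> span a hyperbolic plane. Four independent directions then remain orthogonal to
  that plane, giving rank six on \<open>h\<close>.\<close>

lemma pfaffians_vanish_centralizer:
  assumes h: "lie_subalgebra h" and y: "y \<in> h" and v: "v \<in> h" and z: "bracket y v \<noteq> 0"
    and line: "\<And>u. u \<in> h \<Longrightarrow> bracket y u \<in> span {bracket y v}"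
    and no3: "\<And>\<xi>. \<xi> \<in> dual_space \<Longrightarrow> \<not> symplectic_system \<xi> 3 h"
  shows "pfaffians_vanish {u \<in> h. bracket y u = 0}"
proof (rule ccontr)
  assume "\<not> ?thesis"
  then obtain \<xi>0 a b c d where xi0: "\<xi>0 \<in> dual_space"
    and abcd: "a \<in> h" "b \<in> h" "c \<in> h" "d \<in> h"
      "bracket y a = 0" "bracket y b = 0" "bracket y c = 0" "bracket y d = 0"
    and pf0: "pfaffian \<xi>0 a b c d \<noteq> 0"
    by (auto simp: pfaffians_vanish_def)
  obtain \<eta> where eta: "\<eta> \<in> dual_space" "\<eta> (bracket y v) = 1"
    by (rule exists_functional_nonzero[OF z])
  then obtain \<xi> where xi: "\<xi> \<in> dual_space" "\<xi> (bracket y v) \<noteq> 0" "pfaffian \<xi> a b c d \<noteq> 0"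
    using pfaffian_perturb[OF xi0 eta(1) _ pf0, of "bracket y v"] by auto
  have V: "subspace h" using h by (simp add: lie_subalgebra_def)
  let ?W = "{u \<in> h. \<xi> (bracket y u) = 0 \<and> \<xi> (bracket v u) = 0}"
  \<comment> \<open>An element of the centralizer is orthogonal to \<open>y\<close> already. Adding
    a multiple of \<open>y\<close> makes it orthogonal to \<open>v\<close> and changes no bracket
    inside the centralizer.\<close>
  let ?\<phi> = "\<lambda>u. u + scale (\<xi> (bracket v u) / \<xi> (bracket y v)) y"
  have W: "?\<phi> u \<in> ?W" if "u \<in> h" "bracket y u = 0" for u
    using that y V xi(2) dual_skew[OF xi(1), of v y]
    by (auto simp: bracket_simps dual_simps[OF xi(1)] intro!: subspace_add subspace_scale)
  have form: "bracket (?\<phi> u) (?\<phi> w) = bracket u w" if "bracket y u = 0" "bracket y w = 0" for u w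
    using that bracket_skew[of u y] by (simp add: bracket_simps)
  have "pfaffian \<xi> (?\<phi> a) (?\<phi> b) (?\<phi> c) (?\<phi> d) = pfaffian \<xi> a b c d"
    unfolding pfaffian_def by (simp only: form abcd)
  then have "symplectic_system \<xi> 2 ?W"
    using symplectic_system_2_if_pfaffian[OF xi(1) subspace_perp[OF xi(1) V]
        W[OF abcd(1,5)] W[OF abcd(2,6)] W[OF abcd(3,7)] W[OF abcd(4,8)]] xi(3) by simp
  then have "symplectic_system \<xi> 3 h"
    using y v xi(2) by (simp only: numeral_3_eq_3 numeral_2_eq_2 symplectic_system.simps(2)[of \<xi> "Suc (Suc 0)" h]) blast
  then show False using no3 xi(1) by blast
qed

text \<open>By the Jacobi identity, an element that is central modulo the centre commutes with all
  brackets. This is what makes the hyperplane defined by \<open>\<eta> (bracket y u) = 0\<close>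
  closed under brackets.\<close>

lemma center_bracket_left:
  assumes "lie_subalgebra h" "y \<in> h" "\<And>u. u \<in> h \<Longrightarrow> bracket y u \<in> center h" "u \<in> h" "v \<in> h"
  shows "bracket y (bracket u v) = 0"
proof -
  have "bracket u (bracket v y) = 0" "bracket v (bracket y u) = 0"
    using assms(3-5) center_commute[of "bracket y v" h u] center_commute[of "bracket y u" h v]
      bracket_skew[of v y] by (simp_all add: bracket_minus_right)
  then show ?thesis using jacobi[of y u v] by simp
qed

lemma hyperplane_subalgebra:
  assumes h: "lie_subalgebra h" and y: "y \<in> h" "\<And>u. u \<in> h \<Longrightarrow> bracket y u \<in> center h"
    and v: "v \<in> h" "\<eta> (bracket y v) \<noteq> 0" and eta: "\<eta> \<in> dual_space"
  shows "lie_subalgebra {u \<in> h. \<eta> (bracket y u) = 0}"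
    and "dim h = Suc (dim {u \<in> h. \<eta> (bracket y u) = 0})"
    and "center h \<subseteq> {u \<in> h. \<eta> (bracket y u) = 0}"
proof -
  have V: "subspace h" using h by (simp add: lie_subalgebra_def)
  have "bracket y (bracket u w) = 0" if "u \<in> h" "w \<in> h" for u w
    by (rule center_bracket_left[OF h y that])
  then show "lie_subalgebra {u \<in> h. \<eta> (bracket y u) = 0}"
    using h subspace_kernel[OF dual_bracket[OF eta] V, of y]
    by (auto simp: lie_subalgebra_def dual_0[OF eta])
  show "dim h = Suc (dim {u \<in> h. \<eta> (bracket y u) = 0})"
    by (rule dim_kernel[OF dual_bracket[OF eta] V v])
  show "center h \<subseteq> {u \<in> h. \<eta> (bracket y u) = 0}"
    using y(1) center_commute by (auto simp: center_def dual_0[OF eta])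
qed

section \<open>Commuting systems of quadratic elements\<close>


text \<open>The head is the element added last and its direction kills the tail. So dropping heads
  preserves the condition, and the independent family is the reversed list.\<close>

fun triangular :: "'k mvpoly list \<Rightarrow> bool" where
  "triangular [] = True"
| "triangular (f # fs) = (triangular fs \<and>
     (\<exists>\<xi>\<in>dual_space. dir_deriv \<xi> f \<noteq> 0 \<and> (\<forall>g\<in>set fs. dir_deriv \<xi> g = 0)))"

lemma triangular_drop: "triangular fs \<Longrightarrow> triangular (drop k fs)"
  by (induction fs arbitrary: k) (auto simp: drop_Cons split: nat.split)

lemma triangular_imp_independent:
  "triangular fs \<Longrightarrow> algebraically_independent (length fs) (\<lambda>i. rev fs ! i)"
proof (induction fs)
  case Nil
  show ?case by (simp add: algebraically_independent_0)
next
  case (Cons f fs)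
  then obtain \<xi> where xi: "dir_deriv \<xi> f \<noteq> 0" "\<And>g. g \<in> set fs \<Longrightarrow> dir_deriv \<xi> g = 0" by auto
  let ?f = "\<lambda>i. rev (f # fs) ! i"
  have old: "?f i = rev fs ! i" if "i < length fs" for i
    using that by (simp add: nth_append)
  have "poly_subst ?f P = poly_subst (\<lambda>i. rev fs ! i) P" if "P \<in> poly_ring (length fs)" for P
    by (rule poly_subst_cong[OF that old])
  then have "algebraically_independent (length fs) ?f"
    using Cons by (simp add: algebraically_independent_def)
  moreover have "dir_deriv \<xi> (?f i) = 0" if "i < length fs" for i
    using xi(2)[of "rev fs ! i"] old[OF that] that by (metis length_rev nth_mem set_rev)
  moreover have "dir_deriv \<xi> (?f (length fs)) \<noteq> 0" using xi(1) by (simp add: nth_append)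
  ultimately show ?case
    using algebraically_independent_extend[OF is_derivation_dir_deriv, of "length fs" \<xi> ?f] by simp
qed

definition commuting_system :: "'k mvpoly list \<Rightarrow> bool" where
  "commuting_system fs \<longleftrightarrow> (\<forall>f\<in>set fs. f \<in> poly_ring n \<and> total_degree f \<le> 2) \<and>
     (\<forall>f\<in>set fs. \<forall>g\<in>set fs. poisson_bracket f g = 0) \<and> triangular fs"

text \<open>Always refers to the whole S(g), whichever subalgebra the elements are built from; a
  count reached inside a subalgebra thus needs no transfer.\<close>

definition achievable :: "nat \<Rightarrow> bool" where
  "achievable k \<longleftrightarrow> (\<exists>fs. length fs = k \<and> commuting_system fs)"

lemma achievable_mono:
  assumes "achievable l" "k \<le> l"
  shows "achievable k"
proof -
  obtain fs where fs: "length fs = l" "commuting_system fs" using assms(1) achievable_def by blast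
  have "commuting_system (drop (l - k) fs)"
    using fs(2) set_drop_subset[of "l - k" fs] triangular_drop[of fs "l - k"]
    unfolding commuting_system_def by blast
  moreover have "length (drop (l - k) fs) = k" using fs(1) assms(2) by simp
  ultimately show ?thesis using achievable_def by blast
qed

lemma closed_derivation_kernel: "is_derivation D \<Longrightarrow> closed_subalgebra_ops {p. D p = 0}"
  unfolding closed_subalgebra_ops_def by (auto simp: derivation_simps)

text \<open>Kernels of derivations are subalgebras, so commutation passes from the generators to one
  argument and then to the other. The transcendence degree is squeezed between the length of an
  independent list and the number of generators.\<close>

lemma complete_if_achievable:
  assumes "achievable c" and c: "c_number = real c"
  shows "\<exists>M. complete_poisson_commutative_subalgebra M \<and>
    (\<exists>G \<subseteq> poly_ring n. (\<forall>g\<in>G. total_degree g \<le> 2) \<and> M = generated_subalgebra G)"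
proof -
  obtain fs where fs: "length fs = c" "commuting_system fs" using assms(1) achievable_def by blast
  let ?G = "set fs" and ?M = "generated_subalgebra (set fs)"
  let ?f = "\<lambda>i. rev fs ! i"
  have G: "?G = ?f ` {..<c}"
    using fs(1) nth_image[of c "rev fs"] by (simp add: lessThan_atLeast0)
  have comm: "\<And>f g. f \<in> ?G \<Longrightarrow> g \<in> ?G \<Longrightarrow> poisson_bracket f g = 0"
    using fs(2) by (simp add: commuting_system_def)
  have 1: "poisson_bracket f g = 0" if "f \<in> ?M" "g \<in> ?G" for f g
    using generated_subalgebra_minimal[OF _ closed_derivation_kernel[OF poisson_bracket_left[of g]], of ?G]
      comm that by blast
  have 2: "poisson_bracket f g = 0" if "f \<in> ?M" "g \<in> ?M" for f g
    using generated_subalgebra_minimal[OF _ closed_derivation_kernel[OF poisson_bracket_right[of f]], of ?G]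
      1 that by blast
  have Gn: "?G \<subseteq> poly_ring n" using fs(2) by (auto simp: commuting_system_def)
  then have "?M \<subseteq> poly_ring n"
    by (rule generated_subalgebra_minimal[OF _ closed_subalgebra_poly_ring])
  then have "poisson_commutative_subalgebra ?M"
    using 2 closed_generated_subalgebra
    by (simp add: poisson_commutative_subalgebra_def subalgebra_of_poly_ring_def)
  moreover have "trdeg ?M = enat c"
  proof (rule antisym)
    show "trdeg ?M \<le> enat c" unfolding G by (rule trdeg_generated_le)
    show "enat c \<le> trdeg ?M"
      using triangular_imp_independent[of fs] fs generated_subalgebra_superset[of ?G] G
      by (intro trdeg_ge[of ?f]) (auto simp: commuting_system_def)
  qed
  ultimately have "complete_poisson_commutative_subalgebra ?M"
    by (simp add: complete_poisson_commutative_subalgebra_def c)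
  moreover have "\<forall>g\<in>?G. total_degree g \<le> 2" using fs(2) by (simp add: commuting_system_def)
  ultimately show ?thesis using Gn by blast
qed

lemma total_degree_sym_mult: "total_degree (\<sigma> u * \<sigma> v) \<le> 2"
  using total_degree_mult_le[OF total_degree_sym[of u] total_degree_sym[of v]] by simp

lemma total_degree_const_mult: "total_degree p \<le> D \<Longrightarrow> total_degree (poly_const c * p) \<le> D"
  using total_degree_mult_le[of "poly_const c" 0 p D] by (simp add: total_degree_const)

lemma total_degree_minus: "total_degree (- p) = total_degree (p :: 'k mvpoly)"
proof -
  have "Poly_Mapping.keys (- p) = Poly_Mapping.keys p" by (auto simp: in_keys_iff)
  then show ?thesis by (simp add: total_degree_def)
qed

lemma total_degree_diff_le: "total_degree p \<le> D \<Longrightarrow> total_degree q \<le> D \<Longrightarrow> total_degree (p - q) \<le> D"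
  for p q :: "'k mvpoly"
  using total_degree_add_le[of p D "- q"] by (simp add: total_degree_minus)

lemma total_degree_sym_2: "total_degree (\<sigma> v) \<le> 2"
  using total_degree_sym[of v] by simp

lemmas quadratic_intros = total_degree_add_le total_degree_diff_le total_degree_sym_mult
  total_degree_const_mult total_degree_sym_2 poly_ring_add poly_ring_diff poly_ring_mult
  poly_ring_const sym_in_poly_ring

text \<open>Directions dual to each other within the new block allow it to be prepended in any
  order.\<close>

lemma triangular_append:
  assumes "triangular fs" "distinct as"
    and "\<And>a. a \<in> set as \<Longrightarrow> \<exists>\<xi>\<in>dual_space. dir_deriv \<xi> (u a) \<noteq> 0 \<and> (\<forall>g\<in>set fs. dir_deriv \<xi> g = 0)
        \<and> (\<forall>b\<in>set as. b \<noteq> a \<longrightarrow> dir_deriv \<xi> (u b) = 0)"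
  shows "triangular (map u as @ fs)"
  using assms(2,3)
proof (induction as)
  case Nil
  show ?case using assms(1) by simp
next
  case (Cons a as)
  have "triangular (map u as @ fs)"
  proof (rule Cons.IH)
    show "distinct as" using Cons.prems(1) by simp
  next
    fix b assume "b \<in> set as"
    then show "\<exists>\<xi>\<in>dual_space. dir_deriv \<xi> (u b) \<noteq> 0 \<and> (\<forall>g\<in>set fs. dir_deriv \<xi> g = 0)
        \<and> (\<forall>c\<in>set as. c \<noteq> b \<longrightarrow> dir_deriv \<xi> (u c) = 0)"
      using Cons.prems(2)[of b] by (meson list.set_intros(2))
  qed
  moreover obtain \<xi> where "\<xi> \<in> dual_space" "dir_deriv \<xi> (u a) \<noteq> 0" "\<forall>g\<in>set fs. dir_deriv \<xi> g = 0"
    "\<forall>b\<in>set (a # as). b \<noteq> a \<longrightarrow> dir_deriv \<xi> (u b) = 0"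
    using Cons.prems(2)[of a] by (meson list.set_intros(1))
  moreover have "a \<notin> set as" using Cons.prems(1) by simp
  ultimately show ?case by (auto intro!: bexI[of _ \<xi>])
qed

lemma triangular_linear:
  assumes "independent (set vs)" "distinct vs"
  shows "triangular (map \<sigma> vs)"
proof -
  have "triangular (map \<sigma> vs @ [])"
  proof (rule triangular_append[OF _ assms(2)])
    fix a assume a: "a \<in> set vs"
    obtain \<xi> where "\<xi> \<in> dual_space" "\<forall>v\<in>set vs. \<xi> v = (if v = a then 1 else 0)"
      using exists_functional[OF assms(1), of "\<lambda>v. if v = a then 1 else 0"] by blast
    then show "\<exists>\<xi>\<in>dual_space. dir_deriv \<xi> (\<sigma> a) \<noteq> 0 \<and> (\<forall>g\<in>set []. dir_deriv \<xi> g = 0)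
        \<and> (\<forall>b\<in>set vs. b \<noteq> a \<longrightarrow> dir_deriv \<xi> (\<sigma> b) = 0)"
      using a by (intro bexI[of _ \<xi>]) (auto simp: dir_deriv_sym)
  qed simp
  then show ?thesis by simp
qed

lemma obtain_basis_list:
  assumes "subspace V"
  obtains vs where "distinct vs" "set vs \<subseteq> V" "independent (set vs)" "span (set vs) = V" "length vs = dim V"
proof -
  obtain B where B: "B \<subseteq> V" "independent B" "V \<subseteq> span B" "card B = dim V"
    by (rule basis_exists[of V])
  obtain vs where vs: "set vs = B" "distinct vs"
    using finite_distinct_list[OF finiteI_independent[OF B(2)]] by blast
  have "span B = V" using B(1,3) assms by (simp add: span_subspace)
  then show ?thesis using vs B distinct_card[OF vs(2)] by (intro that[of vs]) auto
qed

section \<open>Commuting systems when all forms have rank at most two\<close>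

lemma achievable_abelian:
  assumes "subspace h" "\<And>u v. u \<in> h \<Longrightarrow> v \<in> h \<Longrightarrow> bracket u v = 0"
  shows "achievable (dim h)"
proof -
  obtain vs where vs: "distinct vs" "set vs \<subseteq> h" "independent (set vs)" "span (set vs) = h" "length vs = dim h"
    by (rule obtain_basis_list[OF assms(1)])
  have "commuting_system (map \<sigma> vs)"
    unfolding commuting_system_def using triangular_linear[OF vs(3,1)] vs(2) assms(2)
    by (auto simp: poisson_bracket_sym subset_iff intro!: quadratic_intros)
  then show ?thesis
    unfolding achievable_def using vs(5) by (intro exI[of _ "map \<sigma> vs"]) simp
qed

lemma pfaffian_sym:
  assumes "\<And>\<xi>. \<xi> \<in> dual_space \<Longrightarrow> pfaffian \<xi> a b c d = 0"
  shows "\<sigma> (bracket a b) * \<sigma> (bracket c d) - \<sigma> (bracket a c) * \<sigma> (bracket b d)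
    + \<sigma> (bracket a d) * \<sigma> (bracket b c) = 0"
proof -
  let ?u = "\<lambda>i::nat. if i = 0 then bracket a b else if i = 1 then - bracket a c else bracket a d"
  let ?v = "\<lambda>i::nat. if i = 0 then bracket c d else if i = 1 then bracket b d else bracket b c"
  have "(\<Sum>i\<in>{0,1,2}. \<sigma> (?u i) * \<sigma> (?v i)) = 0"
    by (rule sum_sym_products_eq_0) (use assms in \<open>auto simp: pfaffian_def dual_minus algebra_simps\<close>)
  then show ?thesis by (simp add: sym_minus algebra_simps)
qed

text \<open>All commutation relations are Pfaffian identities with first arguments \<open>y\<close>
  and \<open>a0\<close>; the nonzero central factor \<open>z a0\<close> can be cancelled because
  S(g) is a domain.\<close>

lemma achievable_pfaffians_vanish:
  assumes h: "lie_subalgebra h" and pf: "pfaffians_vanish h"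
  shows "achievable (dim h - 1)"
proof (cases "h \<subseteq> center h")
  case True
  then have "achievable (dim h)"
    using h by (intro achievable_abelian) (auto simp: lie_subalgebra_def center_def)
  then show ?thesis by (rule achievable_mono) simp
next
  case False
  then obtain y where y: "y \<in> h" "y \<notin> center h" "\<And>u. u \<in> h \<Longrightarrow> bracket u y \<in> center h"
    using exists_second_center[OF h] by blast
  have V: "subspace h" using h by (simp add: lie_subalgebra_def)
  define z where "z = (\<lambda>u. bracket y u)"
  have z_center: "z u \<in> center h" if "u \<in> h" for u
    using y(3)[OF that] subspace_neg[OF subspace_center[OF V]] bracket_skew[of y u] by (simp add: z_def)
  have z_comm: "bracket (z u) v = 0" "bracket v (z u) = 0" if "u \<in> h" "v \<in> h" for u v
    using center_commute[OF z_center[OF that(1)] that(2)] by auto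
  let ?C = "{u \<in> h. z u = 0}"
  have C: "subspace ?C" using V unfolding subspace_def z_def by (simp add: bracket_simps)
  have z_C: "z u \<in> ?C" if "u \<in> h" for u
    using z_center[OF that] z_comm(2)[OF that y(1)] by (simp add: center_def z_def)
  obtain vs where vs: "distinct vs" "set vs \<subseteq> ?C" "independent (set vs)" "span (set vs) = ?C"
    by (rule obtain_basis_list[OF C])
  have "set vs \<subseteq> h" using vs(2) by auto
  obtain B where B: "set vs \<subseteq> B" "B \<subseteq> h" "independent B" "h \<subseteq> span B"
    by (rule maximal_independent_subset_extend[OF \<open>set vs \<subseteq> h\<close> vs(3)])
  have finB: "finite B" by (rule finiteI_independent[OF B(3)])
  have "\<not> B \<subseteq> set vs"
  proof
    assume "B \<subseteq> set vs"
    then have "h \<subseteq> ?C" using B(4) vs(4) span_mono by blast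
    then show False using y(1,2) by (auto simp: center_def z_def)
  qed
  then obtain a0 where a0: "a0 \<in> B" "a0 \<notin> set vs" by blast
  obtain as where as: "set as = B - set vs - {a0}" "distinct as"
    using finite_distinct_list[of "B - set vs - {a0}"] finB by blast
  have h': "a0 \<in> h" "\<And>a. a \<in> set as \<Longrightarrow> a \<in> h" using a0 as(1) B(2) by auto
  have "a0 \<notin> ?C"
  proof
    assume "a0 \<in> ?C"
    then have "a0 \<in> span (set vs)" using vs(4) by simp
    then have "a0 \<in> span (B - {a0})" using span_mono[of "set vs" "B - {a0}"] B(1) a0(2) by blast
    then show False using B(3) a0(1) dependent_def by blast
  qed
  then have z0: "z a0 \<noteq> 0" using h'(1) by simp
  have sym_pf: "\<sigma> (bracket a b) * \<sigma> (bracket c d) - \<sigma> (bracket a c) * \<sigma> (bracket b d)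
      + \<sigma> (bracket a d) * \<sigma> (bracket b c) = 0" if "a \<in> h" "b \<in> h" "c \<in> h" "d \<in> h" for a b c d
    using pf that by (intro pfaffian_sym) (simp add: pfaffians_vanish_def)
  \<comment> \<open>The combination of \<open>a\<close> and \<open>a0\<close> with central
    coefficients that commutes with \<open>y\<close>: its bracket with \<open>y\<close> is z(a0)
    z(a) - z(a) z(a0).\<close>
  define u where "u = (\<lambda>a. \<sigma> (z a0) * \<sigma> a - \<sigma> (z a) * \<sigma> a0)"
  \<comment> \<open>Since \<open>y\<close> commutes with \<open>c\<close> and \<open>d\<close>, only
    the term z(a0)[c,d] of the Pfaffian is left.\<close>
  have C_comm: "bracket c d = 0" if "c \<in> ?C" "d \<in> ?C" for c d
  proof -
    have "\<sigma> (z a0) * \<sigma> (bracket c d) = 0"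
      using sym_pf[of y a0 c d] that y(1) h'(1) by (simp add: z_def)
    then show ?thesis using z0 by simp
  qed
  have Cu: "poisson_bracket (\<sigma> c) (u a) = 0" if "c \<in> ?C" "a \<in> h" for c a
  proof -
    have "poisson_bracket (\<sigma> c) (u a) = \<sigma> (z a0) * \<sigma> (bracket c a) - \<sigma> (z a) * \<sigma> (bracket c a0)"
      using that z_comm(2)[of _ c] h' by (simp add: u_def poisson_simps)
    also have "\<dots> = - (\<sigma> (z a0) * \<sigma> (bracket a c) - \<sigma> (z a) * \<sigma> (bracket a0 c))"
      using bracket_skew[of c a] bracket_skew[of c a0] by (simp add: sym_minus)
    also have "\<dots> = 0" using sym_pf[of y a0 a c] that y(1) h'(1) by (simp add: z_def)
    finally show ?thesis .
  qed
  have uu: "poisson_bracket (u a) (u b) = 0" if "a \<in> h" "b \<in> h" for a b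
  proof -
    have zz: "bracket (z c) (z d) = 0" if "c \<in> h" "d \<in> h" for c d
      using z_comm(1)[OF that(1), of "z d"] z_C[OF that(2)] by simp
    have "poisson_bracket (u a) (u b) = \<sigma> (z a0) *
       (\<sigma> (z a0) * \<sigma> (bracket a b) - \<sigma> (z a) * \<sigma> (bracket a0 b) - \<sigma> (z b) * \<sigma> (bracket a a0))"
      using that z_comm zz h' by (simp add: u_def poisson_simps bracket_self algebra_simps)
    also have "\<dots> = \<sigma> (z a0) *
       (\<sigma> (z a0) * \<sigma> (bracket a b) - \<sigma> (z a) * \<sigma> (bracket a0 b) + \<sigma> (z b) * \<sigma> (bracket a0 a))"
      using bracket_skew[of a a0] by (simp add: sym_minus)
    also have "\<dots> = 0" using sym_pf[of y a0 a b] that y(1) h'(1) by (simp add: z_def)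
    finally show ?thesis .
  qed
  have "triangular (map u as @ map \<sigma> vs)"
  proof (rule triangular_append[OF triangular_linear[OF vs(3,1)] as(2)])
    fix a assume a: "a \<in> set as"
    \<comment> \<open>Dual to \<open>a\<close> in the basis \<open>B\<close>, hence zero on the
      centralizer, which contains all \<open>z b\<close>. The derivative of \<open>u a\<close> is
      therefore \<open>\<sigma> (z a0)\<close>.\<close>
    obtain \<xi> where xi: "\<xi> \<in> dual_space" "\<forall>b\<in>B. \<xi> b = (if b = a then 1 else 0)"
      using exists_functional[OF B(3), of "\<lambda>b. if b = a then 1 else 0"] by blast
    have xi_a: "\<xi> a = 1" "\<xi> a0 = 0" "\<And>b. b \<in> set as \<Longrightarrow> b \<noteq> a \<Longrightarrow> \<xi> b = 0"
      using xi(2) a a0(1) as(1) by auto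
    have xi_vs: "\<xi> v = 0" if "v \<in> set vs" for v
      using xi(2) that B(1) a as(1) by auto
    have "span (set vs) \<subseteq> {v. \<xi> v = 0}"
      using xi_vs subspace_kernel[OF xi(1) subspace_UNIV] by (intro span_minimal) auto
    then have xi_z: "\<xi> (z b) = 0" if "b \<in> h" for b
      using z_C[OF that] vs(4) by auto
    have D: "dir_deriv \<xi> (u b) = poly_const (\<xi> b) * \<sigma> (z a0)" if "b \<in> h" for b
      using xi_z that h'(1) xi_a(2) by (simp add: u_def dir_deriv_simps dir_deriv_sym[OF xi(1)] mult.commute)
    show "\<exists>\<xi>\<in>dual_space. dir_deriv \<xi> (u a) \<noteq> 0 \<and> (\<forall>g\<in>set (map \<sigma> vs). dir_deriv \<xi> g = 0)
        \<and> (\<forall>b\<in>set as. b \<noteq> a \<longrightarrow> dir_deriv \<xi> (u b) = 0)"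
      using D h'(2) a z0 xi_a xi_vs xi(1)
      by (intro bexI[of _ \<xi>] conjI ballI impI) (auto simp: dir_deriv_sym)
  qed
  moreover have "poisson_bracket f g = 0"
    if f: "f \<in> set (map u as @ map \<sigma> vs)" and g: "g \<in> set (map u as @ map \<sigma> vs)" for f g
  proof -
    have uC: "poisson_bracket (u a) (\<sigma> c) = 0" if "c \<in> ?C" "a \<in> h" for c a
      using Cu[OF that] poisson_bracket_skew[of "u a" "\<sigma> c"] by simp
    have CC: "poisson_bracket (\<sigma> c) (\<sigma> d) = 0" if "c \<in> ?C" "d \<in> ?C" for c d
      using C_comm[OF that] by (simp add: poisson_bracket_sym)
    have "f \<in> u ` h \<union> \<sigma> ` ?C" "g \<in> u ` h \<union> \<sigma> ` ?C" using f g h'(2) vs(2) by auto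
    then show ?thesis using uu Cu uC CC by blast
  qed
  ultimately have "commuting_system (map u as @ map \<sigma> vs)"
    unfolding commuting_system_def by (auto simp: u_def intro!: quadratic_intros)
  \<comment> \<open>The one element lost is \<open>a0\<close>, because
    \<open>u a0 = 0\<close>.\<close>
  moreover have "length (map u as @ map \<sigma> vs) = dim h - 1"
  proof -
    have "length as = card (B - set vs) - 1"
      using as a0 by (simp add: distinct_card[symmetric] card_Diff_singleton_if)
    also have "card (B - set vs) = card B - length vs"
      using B(1) vs(1) by (simp add: card_Diff_subset distinct_card)
    finally have "length as = dim h - length vs - 1" using basis_card_eq_dim[OF B(2,4,3)] by simp
    moreover have "length vs < card B"
      using psubset_card_mono[OF finB, of "set vs"] B(1) a0 vs(1) by (auto simp: distinct_card)
    ultimately show ?thesis using basis_card_eq_dim[OF B(2,4,3)] by simp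
  qed
  ultimately show ?thesis unfolding achievable_def by blast
qed


section \<open>The exceptional case in dimension seven\<close>

text \<open>Chosen so that its partial derivative in the direction of \<open>p\<close> is \<open>s p - r q + m2\<close> and the one
  in the direction of \<open>q\<close> is \<open>-(r p + t q + m1)\<close>.\<close>

definition quad :: "'g \<Rightarrow> 'g \<Rightarrow> 'k \<Rightarrow> 'k \<Rightarrow> 'k \<Rightarrow> 'g \<Rightarrow> 'g \<Rightarrow> 'k mvpoly" where
  "quad p q r s t m1 m2 = poly_const (s / 2) * (\<sigma> p * \<sigma> p) - poly_const (t / 2) * (\<sigma> q * \<sigma> q)
     - poly_const r * (\<sigma> p * \<sigma> q) + \<sigma> m2 * \<sigma> p - \<sigma> m1 * \<sigma> q"

text \<open>The linear parts of p -> r p + t q + m1 and q -> s p - r q + m2 form a traceless matrix.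
  This is the equality of mixed derivatives that lets a single quadratic have both prescribed
  partial derivatives.\<close>

lemma derivation_quad:
  assumes D: "is_derivation D" and "D (\<sigma> m1) = 0" "D (\<sigma> m2) = 0"
  shows "D (quad p q r s t m1 m2)
    = \<sigma> (scale s p - scale r q + m2) * D (\<sigma> p) - \<sigma> (scale r p + scale t q + m1) * D (\<sigma> q)"
proof -
  have half: "poly_const c = poly_const (c / 2) + (poly_const (c / 2) :: 'k mvpoly)" for c
    by (simp add: poly_const_add[symmetric])
  show ?thesis
    using assms(2,3)
    by (simp add: quad_def derivation_simps[OF D] sym_simps half[of s] half[of t] algebra_simps)
qed

text \<open>If the centralizer \<open>C\<close> of \<open>y\<close> is not abelian, it is a
  three-dimensional central part \<open>K\<close> plus two directions paired by \<open>w\<close>,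
  where traceless derivations acting trivially on \<open>K\<close> are Hamiltonian. The Hamiltonians
  replace the missing commuting linear elements; the target 5 is dim h - 2.\<close>

lemma achievable_two_dim_center:
  assumes h: "lie_subalgebra h" and dimh: "dim h = 7" and dimZ: "dim (center h) \<le> 2"
    and y: "y \<in> h" "y \<notin> center h" "\<And>u. u \<in> h \<Longrightarrow> bracket y u \<in> center h"
    and not_line: "\<And>v. v \<in> h \<Longrightarrow> bracket y v \<noteq> 0 \<Longrightarrow> \<exists>u\<in>h. bracket y u \<notin> span {bracket y v}"
  shows "achievable 5"
proof -
  have V: "subspace h" using h by (simp add: lie_subalgebra_def)
  note Z = subspace_center[OF V]
  have Zh: "center h \<subseteq> h" by (auto simp: center_def)
  obtain v1 where v1: "v1 \<in> h" "bracket y v1 \<noteq> 0" using y(1,2) by (auto simp: center_def)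
  obtain v2 where v2: "v2 \<in> h" "bracket y v2 \<notin> span {bracket y v1}" using not_line[OF v1] by blast
  have sub: "insert (bracket y v2) {bracket y v1} \<subseteq> center h" using y(3) v1 v2 by simp
  have dim2: "dim (insert (bracket y v2) {bracket y v1}) = 2"
    using v1 v2 by (simp add: dim_insert)
  have spanZ: "span (insert (bracket y v2) {bracket y v1}) = center h"
    by (rule subspace_dim_equal[OF subspace_span Z span_minimal[OF sub Z]])
       (use dim2 dimZ in \<open>simp add: dim_span\<close>)
  have dimZ2: "dim (center h) = 2" using spanZ dim2 dim_span by metis
  have surj: "\<exists>v\<in>h. bracket y v = z" if z: "z \<in> center h" for z
  proof -
    obtain k where "z - scale k (bracket y v2) \<in> span {bracket y v1}"
      using z spanZ span_breakdown_eq by blast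
    then obtain l where "z - scale k (bracket y v2) = scale l (bracket y v1)"
      by (auto simp: span_singleton)
    then have "bracket y (scale k v2 + scale l v1) = z"
      by (simp add: bracket_simps algebra_simps)
    moreover have "scale k v2 + scale l v1 \<in> h"
      using V v1 v2 by (intro subspace_add subspace_scale)
    ultimately show ?thesis by blast
  qed
  define C where "C = {u \<in> h. bracket y u = 0}"
  have C: "subspace C" using V unfolding subspace_def C_def by (simp add: bracket_simps)
  have Ch: "C \<subseteq> h" by (auto simp: C_def)
  have CC: "bracket u v \<in> C" if "u \<in> h" "v \<in> h" for u v
    using h center_bracket_left[OF h y(1,3) that] that by (simp add: C_def lie_subalgebra_def)
  \<comment> \<open>\<open>C\<close> is the kernel of bracketing with \<open>y\<close>, a map whose
    image is the two-dimensional centre.\<close>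
  have dimC: "dim C = 5"
  proof -
    have v1C: "v1 \<notin> C" using v1 by (simp add: C_def)
    have "v2 \<notin> span (insert v1 C)"
    proof
      assume "v2 \<in> span (insert v1 C)"
      then obtain k where "v2 - scale k v1 \<in> span C" using span_breakdown_eq by blast
      then have "v2 - scale k v1 \<in> C" by (simp add: span_eq_iff[THEN iffD2, OF C])
      then have "bracket y v2 = scale k (bracket y v1)" by (simp add: C_def bracket_simps)
      then show False using v2(2) by (auto simp: span_singleton)
    qed
    then have eq: "dim (insert v2 (insert v1 C)) = dim C + 2"
      using dim_insert_notin[OF C v1C] by (simp add: dim_insert)
    have "dim (insert v2 (insert v1 C)) \<le> dim h" using v1 v2 Ch by (intro dim_subset) auto
    moreover have "h \<subseteq> span (insert v2 (insert v1 C))"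
    proof
      fix u assume u: "u \<in> h"
      obtain k where "bracket y u - scale k (bracket y v2) \<in> span {bracket y v1}"
        using y(3)[OF u] spanZ span_breakdown_eq by blast
      then obtain l where "bracket y u - scale k (bracket y v2) = scale l (bracket y v1)"
        by (auto simp: span_singleton)
      then have "bracket y (u - scale k v2 - scale l v1) = 0" by (simp add: bracket_simps)
      then have "u - scale k v2 - scale l v1 \<in> C"
        using u v1 v2 V by (auto simp: C_def intro!: subspace_diff subspace_scale)
      then show "u \<in> span (insert v2 (insert v1 C))"
        unfolding span_breakdown_eq by (intro exI[of _ k] exI[of _ l] span_base)
    qed
    then have "dim h \<le> dim (insert v2 (insert v1 C))" by (rule dim_mono)
    ultimately show ?thesis using eq dimh by simp
  qed
  show ?thesis
  proof (cases "\<forall>u\<in>C. \<forall>v\<in>C. bracket u v = 0")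
    case True
    then show ?thesis using achievable_abelian[OF C] dimC by simp
  next
    case False
    then obtain p q where pq: "p \<in> C" "q \<in> C" "bracket p q \<noteq> 0" by blast
    define w where "w = bracket p q"
    define K where "K = span (insert y (center h))"
    have K: "subspace K" by (simp add: K_def)
    have dimK: "dim K = 3" unfolding K_def using dim_insert_notin[OF Z y(2)] dimZ2 by simp
    have yK: "y \<in> K" and ZK: "center h \<subseteq> K" unfolding K_def by (auto intro: span_base)
    have yC: "y \<in> C" using y(1) by (simp add: C_def bracket_self)
    have ZC: "center h \<subseteq> C" using center_commute[OF _ y(1)] Zh by (auto simp: C_def)
    have K_comm: "bracket c k = 0" "bracket k c = 0" if k: "k \<in> K" and c: "c \<in> C" for k c
    proof -
      obtain l where "k - scale l y \<in> center h"
        using k span_breakdown_eq[of k y "center h"] by (auto simp: K_def span_eq_iff[THEN iffD2, OF Z])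
      moreover have "c \<in> h" "bracket y c = 0" using c by (auto simp: C_def)
      ultimately have "bracket (k - scale l y + scale l y) c = 0"
        using center_commute[of "k - scale l y" h c] by (simp only: bracket_simps) simp
      then show "bracket k c = 0" by simp
      then show "bracket c k = 0" using bracket_skew[of c k] by simp
    qed
    have KC: "K \<subseteq> C" unfolding K_def using yC ZC C by (intro span_minimal) auto
    \<comment> \<open>If \<open>p\<close> and \<open>q\<close> were dependent modulo
      \<open>K\<close>, they would commute, as \<open>K\<close> is central in
      \<open>C\<close>.\<close>
    have qp_K: "q \<notin> span (insert p K)" and pq_K: "p \<notin> span (insert q K)"
    proof -
      have "False" if k: "u - scale k v \<in> K" and uv: "u \<in> C" "v \<in> C" "bracket u v \<noteq> 0" for u v k
        using K_comm(2)[OF k uv(2)] uv(3) by (simp add: bracket_simps)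
      moreover have "bracket q p \<noteq> 0" using pq(3) bracket_skew[of p q] by auto
      ultimately show "q \<notin> span (insert p K)" "p \<notin> span (insert q K)"
        using pq by (auto simp: span_breakdown_eq span_eq_iff[THEN iffD2, OF K])
    qed
    have qK: "q \<notin> K" using qp_K span_base[of q "insert p K"] by blast
    have "dim (insert p (insert q K)) = 5"
      using dim_insert_notin[OF K qK] pq_K dimK by (simp add: dim_insert)
    then have spanC: "span (insert p (insert q K)) = C"
      using pq KC dimC by (intro subspace_dim_equal[OF subspace_span C] span_minimal C) auto
    have coeffs: "\<exists>r s l. l \<in> K \<and> u = scale r p + scale s q + l" if u: "u \<in> C" for u
    proof -
      obtain r where "u - scale r p \<in> span (insert q K)"
        using u spanC span_breakdown_eq by blast
      then obtain s where "u - scale r p - scale s q \<in> K"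
        using span_breakdown_eq[of "u - scale r p" q K] by (auto simp: span_eq_iff[THEN iffD2, OF K])
      moreover have "u = scale r p + scale s q + (u - scale r p - scale s q)" by simp
      ultimately show ?thesis by blast
    qed
    have bracket_p: "bracket p (scale r p + scale s q + l) = scale s w"
      and bracket_q: "bracket (scale r p + scale s q + l) q = scale r w" if "l \<in> K" for r s l
      using K_comm[OF that] pq by (simp_all add: bracket_simps w_def)
    have wh: "w \<in> h" using h pq(1,2) Ch by (auto simp: w_def lie_subalgebra_def)
    have ad_w: "bracket v w = bracket (bracket v p) q + bracket p (bracket v q)" for v
      using jacobi[of v p q] bracket_skew[of q "bracket v p"] bracket_skew[of q v]
      by (simp add: w_def bracket_minus_right algebra_simps)
    \<comment> \<open>Being a derivation, bracketing with \<open>v\<close> multiplies [p,q] by the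
      trace of its action on \<open>C\<close> modulo \<open>K\<close>; nilpotency forbids a nonzero
      eigenvalue.\<close>
    have w_comm: "bracket v w = 0" if v: "v \<in> h" for v
    proof -
      have "bracket v p \<in> C" "bracket v q \<in> C" using CC v pq Ch by auto
      then obtain r s l r' s' l' where "l \<in> K" "bracket v p = scale r p + scale s q + l"
        "l' \<in> K" "bracket v q = scale r' p + scale s' q + l'" using coeffs by metis
      then have "bracket v w = scale (r + s') w"
        using ad_w[of v] bracket_p bracket_q by (simp add: scale_left_distrib)
      then show ?thesis by (rule bracket_eigenvalue)
    qed
    have wZ: "w \<in> center h" unfolding center_def
      using wh w_comm bracket_skew[of w] by auto
    have w0: "w \<noteq> 0" using pq by (simp add: w_def)
    have wK: "w \<in> K" using wZ ZK by blast
    \<comment> \<open>The sign gives [b,y] = w. \<open>a\<close> is then taken so that its bracket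
      with \<open>y\<close> leaves the line of \<open>w\<close>.\<close>
    obtain b where b: "b \<in> h" "bracket y b = - w"
      using surj[of "- w"] subspace_neg[OF Z wZ] by blast
    obtain a where a: "a \<in> h" "bracket y a \<notin> span {- w}"
      using not_line[OF b(1)] b(2) w0 by auto
    have a_w: "bracket y a \<notin> span {w}"
    proof
      assume "bracket y a \<in> span {w}"
      then obtain k where "bracket y a = scale (- k) (- w)" by (auto simp: span_singleton)
      then show False using a(2) by (simp only: span_scale span_base singletonI not_True_eq_False)
    qed
    define z where "z = bracket a y"
    have ya: "bracket y a = - z" using bracket_skew[of y a] by (simp add: z_def)
    have zZ: "z \<in> center h" using y(3)[OF a(1)] subspace_neg[OF Z, of "bracket y a"] by (simp add: ya)
    have zw: "z \<notin> span {w}" using a_w ya span_neg[of z "{w}"] by auto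
    have zK: "z \<in> K" using zZ ZK by blast
    have central: "bracket z v = 0" "bracket v z = 0" "bracket w v = 0" "bracket v w = 0" if "v \<in> h" for v
      using center_commute[OF zZ that] center_commute[OF wZ that] by auto
    \<comment> \<open>That \<open>w\<close> is central says that this trace is zero, which is the
      shape \<open>quad\<close> requires.\<close>
    have coeffs_traceless: "\<exists>r s t l1 l2. l1 \<in> K \<and> l2 \<in> K \<and>
        bracket v p = scale r p + scale t q + l1 \<and> bracket v q = scale s p - scale r q + l2"
      if v: "v \<in> h" for v
    proof -
      have "bracket v p \<in> C" "bracket v q \<in> C" using CC v pq Ch by auto
      then obtain r t l1 s r' l2 where l: "l1 \<in> K" "bracket v p = scale r p + scale t q + l1"
        "l2 \<in> K" "bracket v q = scale s p + scale r' q + l2" using coeffs by metis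
      then have "scale (r + r') w = 0"
        using ad_w[of v] bracket_p bracket_q w_comm[OF v] by (simp add: scale_left_distrib)
      then have "r' = - r" using w0 by (simp add: eq_neg_iff_add_eq_0 add.commute)
      then show ?thesis using l
        by (intro exI[of _ r] exI[of _ s] exI[of _ t] exI[of _ l1] exI[of _ l2]) simp
    qed
    obtain r s t l1 l2 where la: "l1 \<in> K" "l2 \<in> K"
      "bracket a p = scale r p + scale t q + l1" "bracket a q = scale s p - scale r q + l2"
      using coeffs_traceless[OF a(1)] by blast
    obtain r' s' t' m1 m2 where lb: "m1 \<in> K" "m2 \<in> K"
      "bracket b p = scale r' p + scale t' q + m1" "bracket b q = scale s' p - scale r' q + m2"
      using coeffs_traceless[OF b(1)] by blast
    define Qa where "Qa = quad p q r s t l1 l2"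
    define Qb where "Qb = quad p q r' s' t' m1 m2"
    have D_Qa: "D Qa = \<sigma> (bracket a q) * D (\<sigma> p) - \<sigma> (bracket a p) * D (\<sigma> q)"
      if "is_derivation D" "\<And>k. k \<in> K \<Longrightarrow> D (\<sigma> k) = 0" for D
      using derivation_quad[OF that(1) that(2)[OF la(1)] that(2)[OF la(2)]] la by (simp add: Qa_def)
    have D_Qb: "D Qb = \<sigma> (bracket b q) * D (\<sigma> p) - \<sigma> (bracket b p) * D (\<sigma> q)"
      if "is_derivation D" "\<And>k. k \<in> K \<Longrightarrow> D (\<sigma> k) = 0" for D
      using derivation_quad[OF that(1) that(2)[OF lb(1)] that(2)[OF lb(2)]] lb by (simp add: Qb_def)
    \<comment> \<open>The first two terms balance against \<open>y\<close>: w[y,a] - z[y,b] = -wz +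
      zw = 0. Subtracting \<open>Qa\<close> cancels w times the action of \<open>a\<close> on
      \<open>p\<close> and \<open>q\<close>, which leaves only z times that of
      \<open>b\<close>.\<close>
    define u where "u = \<sigma> w * \<sigma> a - \<sigma> z * \<sigma> b - Qa"
    \<comment> \<open>If \<open>b\<close> centralises \<open>p\<close> and \<open>q\<close>, then
      \<open>Qb\<close> is the zero polynomial and cannot serve.\<close>
    define g where "g = (if bracket b p = 0 \<and> bracket b q = 0 then \<sigma> p else Qb)"
    let ?P = poisson_bracket
    have P_K: "?P (\<sigma> c) (\<sigma> k) = 0" if "k \<in> K" "c \<in> C" for k c
      using K_comm[OF that] by (simp add: poisson_bracket_sym)
    have P_C_Qa: "?P (\<sigma> c) Qa = \<sigma> (bracket a q) * \<sigma> (bracket c p) - \<sigma> (bracket a p) * \<sigma> (bracket c q)"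
      if "c \<in> C" for c
      using D_Qa[OF poisson_bracket_right P_K] that by (simp add: poisson_bracket_sym)
    have P_C_Qb: "?P (\<sigma> c) Qb = \<sigma> (bracket b q) * \<sigma> (bracket c p) - \<sigma> (bracket b p) * \<sigma> (bracket c q)"
      if "c \<in> C" for c
      using D_Qb[OF poisson_bracket_right P_K] that by (simp add: poisson_bracket_sym)
    have P_C_u: "?P (\<sigma> c) u = \<sigma> w * \<sigma> (bracket c a) - \<sigma> z * \<sigma> (bracket c b)
        - (\<sigma> (bracket a q) * \<sigma> (bracket c p) - \<sigma> (bracket a p) * \<sigma> (bracket c q))" if "c \<in> C" for c
      using P_C_Qa[OF that] central(2,4)[of c] that Ch by (auto simp: u_def poisson_simps)
    have K_u: "?P (\<sigma> k) u = 0" if k: "k \<in> K" for k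
    proof -
      obtain l where l: "k - scale l y \<in> center h"
        using k span_breakdown_eq[of k y "center h"] by (auto simp: K_def span_eq_iff[THEN iffD2, OF Z])
      have "bracket (k - scale l y + scale l y) v = scale l (bracket y v)" if "v \<in> h" for v
        using center_commute[OF l that] by (simp only: bracket_add_left bracket_scale_left) simp
      then have kv: "bracket k v = scale l (bracket y v)" if "v \<in> h" for v using that by simp
      have "k \<in> C" using k KC by blast
      then show ?thesis
        using P_C_u[OF \<open>k \<in> C\<close>] K_comm(2)[OF k pq(1)] K_comm(2)[OF k pq(2)] kv[OF a(1)] kv[OF b(1)]
        by (simp add: ya b(2) sym_simps)
    qed
    have p_u: "?P (\<sigma> p) u = \<sigma> z * \<sigma> (bracket b p)"
      using P_C_u[OF pq(1)] bracket_skew[of p a] bracket_skew[of p b]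
      by (simp add: bracket_self sym_minus w_def[symmetric])
    have q_u: "?P (\<sigma> q) u = \<sigma> z * \<sigma> (bracket b q)"
      using P_C_u[OF pq(2)] bracket_skew[of q a] bracket_skew[of q b] bracket_skew[of q p]
      by (simp add: bracket_self sym_minus w_def[symmetric])
    \<comment> \<open>The bracket with \<open>u\<close> sends \<open>p\<close> and \<open>q\<close>
      to z[b,p] and z[b,q], so the two terms of \<open>D_Qb\<close> cancel. If these brackets
      vanish, \<open>p\<close> itself commutes with \<open>u\<close>.\<close>
    have g_u: "?P g u = 0"
      using D_Qb[OF poisson_bracket_left K_u] p_u q_u by (auto simp: g_def)
    have K_g: "?P (\<sigma> k) g = 0" if "k \<in> K" for k
      using P_C_Qb[of k] K_comm[OF that] pq KC that by (auto simp: g_def poisson_bracket_sym)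
    have KK: "?P (\<sigma> k) (\<sigma> l) = 0" if "k \<in> K" "l \<in> K" for k l
      using P_K that KC by blast
    have self: "?P f f = 0" for f
    proof -
      have "?P f f + ?P f f = 0" using poisson_bracket_skew[of f f] by (simp only: eq_neg_iff_add_eq_0)
      then have "poly_const 2 * ?P f f = 0"
        using poly_const_add[of "1::'k" 1] by (simp add: distrib_right)
      then show ?thesis by simp
    qed
    have comm: "\<forall>f\<in>set [u, g, \<sigma> y, \<sigma> z, \<sigma> w]. \<forall>f'\<in>set [u, g, \<sigma> y, \<sigma> z, \<sigma> w]. ?P f f' = 0"
      using g_u poisson_bracket_skew[of u g] K_u[OF yK] K_u[OF zK] K_u[OF wK]
        K_g[OF yK] K_g[OF zK] K_g[OF wK] poisson_bracket_skew[of u "\<sigma> y"] poisson_bracket_skew[of u "\<sigma> z"]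
        poisson_bracket_skew[of u "\<sigma> w"] poisson_bracket_skew[of g "\<sigma> y"]
        poisson_bracket_skew[of g "\<sigma> z"] poisson_bracket_skew[of g "\<sigma> w"] KK yK zK wK self
      by simp
    have deg: "\<forall>f\<in>set [u, g, \<sigma> y, \<sigma> z, \<sigma> w]. f \<in> poly_ring n \<and> total_degree f \<le> 2"
      by (auto simp: u_def g_def Qa_def Qb_def quad_def intro!: quadratic_intros)
    have "independent {y, z, w}"
    proof -
      have "independent {z, w}" using zw w0 by (intro independent_insertI) (auto simp: independent_empty)
      moreover have "y \<notin> span {z, w}"
        using span_minimal[of "{z, w}" "center h"] Z zZ wZ y(2) by blast
      ultimately show ?thesis by (rule independent_insertI[rotated])
    qed
    moreover have "distinct [y, z, w]"
      using zw y(2) zZ wZ span_base[of w "{w}"] by auto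
    ultimately have tri3: "triangular [\<sigma> y, \<sigma> z, \<sigma> w]"
      using triangular_linear[of "[y, z, w]"] by simp
    have tri4: "triangular [g, \<sigma> y, \<sigma> z, \<sigma> w]"
    proof -
      have "\<exists>\<xi>\<in>dual_space. dir_deriv \<xi> g \<noteq> 0 \<and> (\<forall>k\<in>K. \<xi> k = 0)"
      \<comment> \<open>Along the directions dual to \<open>p\<close> and \<open>q\<close> modulo
        \<open>K\<close>, \<open>Qb\<close> has derivatives [b,q] and -[b,p]; a nonzero one is
        chosen. The first direction also serves when \<open>g\<close> is
        \<open>\<sigma> p\<close>.\<close>
      proof (cases "bracket b q = 0 \<and> bracket b p \<noteq> 0")
        case True
        obtain \<xi> where xi: "\<xi> \<in> dual_space" "\<xi> q = 1" "\<forall>v\<in>span (insert p K). \<xi> v = 0"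
          using exists_functional_subspace[OF subspace_span qp_K] by blast
        have k: "\<xi> k = 0" if "k \<in> K" for k using xi(3) that by (auto intro: span_base)
        have "dir_deriv \<xi> Qb = - \<sigma> (bracket b p)"
          using D_Qb[OF is_derivation_dir_deriv, of \<xi>] True k xi(2)
          by (simp add: dir_deriv_sym[OF xi(1)])
        then show ?thesis using True k xi(1) by (intro bexI[of _ \<xi>]) (auto simp: g_def)
      next
        case False
        obtain \<xi> where xi: "\<xi> \<in> dual_space" "\<xi> p = 1" "\<forall>v\<in>span (insert q K). \<xi> v = 0"
          using exists_functional_subspace[OF subspace_span pq_K] by blast
        have k: "\<xi> k = 0" if "k \<in> insert q K" for k using xi(3) that by (auto intro: span_base)
        have "dir_deriv \<xi> Qb = \<sigma> (bracket b q)"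
          using D_Qb[OF is_derivation_dir_deriv, of \<xi>] k xi(2)
          by (simp add: dir_deriv_sym[OF xi(1)])
        then show ?thesis using False k xi(1,2)
          by (intro bexI[of _ \<xi>]) (auto simp: g_def dir_deriv_sym)
      qed
      then show ?thesis using tri3 yK zK wK by (auto simp: dir_deriv_sym)
    qed
    have tri5: "triangular [u, g, \<sigma> y, \<sigma> z, \<sigma> w]"
    proof -
      have aC: "a \<notin> span (insert b C)"
      proof
        assume "a \<in> span (insert b C)"
        then obtain k where "a - scale k b \<in> C"
          using span_breakdown_eq[of a b C] by (auto simp: span_eq_iff[THEN iffD2, OF C])
        then have "bracket y a = scale (- k) w" by (simp add: C_def bracket_simps b(2) eq_neg_iff_add_eq_0)
        then show False using a_w by (simp only: span_scale span_base singletonI not_True_eq_False)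
      qed
      \<comment> \<open>Along this direction only the term w a of \<open>u\<close> contributes, and
        every other element of the list is constant.\<close>
      obtain \<xi> where xi: "\<xi> \<in> dual_space" "\<xi> a = 1" "\<forall>v\<in>span (insert b C). \<xi> v = 0"
        using exists_functional_subspace[OF subspace_span aC] by blast
      have C0: "\<xi> c = 0" if "c \<in> insert b C" for c using xi(3) that by (auto intro: span_base)
      have zeros: "\<xi> w = 0" "\<xi> z = 0" "\<xi> y = 0" "\<xi> b = 0" "\<xi> p = 0" "\<xi> q = 0" "\<And>k. k \<in> K \<Longrightarrow> \<xi> k = 0"
        using C0 wK zK yK KC pq by auto
      have "dir_deriv \<xi> Qa = 0" "dir_deriv \<xi> Qb = 0"
        using D_Qa[OF is_derivation_dir_deriv, of \<xi>] D_Qb[OF is_derivation_dir_deriv, of \<xi>] zeros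
        by (simp_all add: dir_deriv_sym[OF xi(1)])
      then have "dir_deriv \<xi> u = \<sigma> w" "dir_deriv \<xi> g = 0"
        using zeros xi(2) by (simp_all add: u_def g_def dir_deriv_simps dir_deriv_sym[OF xi(1)])
      then show ?thesis using tri4 w0 xi(1) zeros
        by (auto simp: dir_deriv_sym intro!: bexI[of _ \<xi>])
    qed
    have "commuting_system [u, g, \<sigma> y, \<sigma> z, \<sigma> w]"
      unfolding commuting_system_def using deg comm tri5 by blast
    then show ?thesis unfolding achievable_def by (intro exI[of _ "[u, g, \<sigma> y, \<sigma> z, \<sigma> w]"]) simp
  qed
qed


section \<open>Rank bounds and the case distinction on r\<close>

text \<open>The inequality is strict because a nonabelian \<open>h\<close> has a nonzero central
  element, namely a bracket with an element of the second centre, and central elements lie in every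
  radical.\<close>

lemma symplectic_system_bound:
  assumes xi: "\<xi> \<in> dual_space" and h: "lie_subalgebra h" and sys: "symplectic_system \<xi> s h" and s: "s \<noteq> 0"
  shows "2 * s < dim h"
proof -
  have V: "subspace h" using h by (simp add: lie_subalgebra_def)
  obtain e f where ef: "e \<in> h" "f \<in> h" "\<xi> (bracket e f) \<noteq> 0"
    using sys s by (cases s) auto
  then have "bracket e f \<noteq> 0" using dual_0[OF xi] by auto
  then have "e \<notin> center h" using ef(2) by (auto simp: center_def)
  then obtain y where y: "y \<in> h" "y \<notin> center h" "\<And>u. u \<in> h \<Longrightarrow> bracket u y \<in> center h"
    using exists_second_center[OF h ef(1)] by blast
  then obtain v where v: "v \<in> h" "bracket y v \<noteq> 0" by (auto simp: center_def)
  then have "bracket v y \<in> center h" "bracket v y \<noteq> 0" using y(3) bracket_skew[of y v] by auto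
  then have "dim (center h) \<noteq> 0" by auto
  moreover have "2 * s + dim (center h) \<le> dim h"
  proof (rule symplectic_system_dim[OF xi V _ _ sys])
    show "center h \<subseteq> h" by (auto simp: center_def)
    show "\<xi> (bracket v u) = 0" if "u \<in> center h" "v \<in> h" for u v
      using center_commute[OF that] by (simp add: dual_0[OF xi])
  qed
  ultimately show ?thesis by linarith
qed

text \<open>A hyperplane subalgebra with vanishing Pfaffians yields one element fewer than its
  dimension, which is dim h - 2. Outside the exceptional case it remains to find such a
  hyperplane.\<close>

lemma achievable_no_system_3:
  assumes h: "lie_subalgebra h" and dimh: "dim h \<le> 7"
    and no3: "\<And>\<xi>. \<xi> \<in> dual_space \<Longrightarrow> \<not> symplectic_system \<xi> 3 h"
  shows "achievable (dim h - 2)"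
proof (cases "h \<subseteq> center h")
  case True
  then have "achievable (dim h)"
    using h by (intro achievable_abelian) (auto simp: lie_subalgebra_def center_def)
  then show ?thesis by (rule achievable_mono) simp
next
  case False
  then obtain y where y: "y \<in> h" "y \<notin> center h" "\<And>u. u \<in> h \<Longrightarrow> bracket u y \<in> center h"
    using exists_second_center[OF h] by blast
  have V: "subspace h" using h by (simp add: lie_subalgebra_def)
  note Z = subspace_center[OF V]
  have yZ: "bracket y u \<in> center h" if "u \<in> h" for u
    using y(3)[OF that] subspace_neg[OF Z] bracket_skew[of y u] by simp
  have reduce: "achievable (dim h - 2)"
    if v: "v \<in> h" and eta: "\<eta> \<in> dual_space" "\<eta> (bracket y v) \<noteq> 0"
      and pf: "pfaffians_vanish {u \<in> h. \<eta> (bracket y u) = 0}" for v \<eta>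
  proof -
    note hyp = hyperplane_subalgebra[OF h y(1) yZ v eta(2,1)]
    show ?thesis using achievable_pfaffians_vanish[OF hyp(1) pf] hyp(2) by simp
  qed
  show ?thesis
  proof (cases "\<exists>v\<in>h. bracket y v \<noteq> 0 \<and> (\<forall>u\<in>h. bracket y u \<in> span {bracket y v})")
    case True
    then obtain v where v: "v \<in> h" "bracket y v \<noteq> 0" "\<And>u. u \<in> h \<Longrightarrow> bracket y u \<in> span {bracket y v}"
      by blast
    obtain \<eta> where eta: "\<eta> \<in> dual_space" "\<eta> (bracket y v) = 1"
      by (rule exists_functional_nonzero[OF v(2)])
    \<comment> \<open>\<open>\<eta>\<close> is injective on the line of brackets with
      \<open>y\<close>, so the hyperplane is the centralizer of \<open>y\<close>.\<close>
    have "\<eta> (bracket y u) = 0 \<longleftrightarrow> bracket y u = 0" if u: "u \<in> h" for u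
    proof -
      obtain k where "bracket y u = scale k (bracket y v)"
        using v(3)[OF u] by (auto simp: span_singleton)
      then show ?thesis using eta v(2) by (simp add: dual_simps)
    qed
    then have "{u \<in> h. \<eta> (bracket y u) = 0} = {u \<in> h. bracket y u = 0}" by auto
    then show ?thesis
      using pfaffians_vanish_centralizer[OF h y(1) v no3] reduce[OF v(1) eta(1)] eta(2) by simp
  next
    case no_line: False
    then have not_line: "\<exists>u\<in>h. bracket y u \<notin> span {bracket y v}" if "v \<in> h" "bracket y v \<noteq> 0" for v
      using that by blast
    obtain v where v: "v \<in> h" "bracket y v \<noteq> 0" using y(1,2) by (auto simp: center_def)
    obtain u where u: "u \<in> h" "bracket y u \<notin> span {bracket y v}" using not_line[OF v] by blast
    have "dim (insert (bracket y u) {bracket y v}) \<le> dim (center h)"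
      using yZ u(1) v(1) by (intro dim_subset) simp
    then have dimZ: "2 \<le> dim (center h)" using u(2) v(2) by (simp add: dim_insert)
    show ?thesis
    proof (cases "dim h = 7 \<and> dim (center h) \<le> 2")
      case True
      then show ?thesis using achievable_two_dim_center[OF h _ _ y(1,2) yZ not_line] by simp
    next
      case False
      obtain \<eta> where eta: "\<eta> \<in> dual_space" "\<eta> (bracket y v) = 1"
        by (rule exists_functional_nonzero[OF v(2)])
      then have ne: "\<eta> (bracket y v) \<noteq> 0" by simp
      note hyp = hyperplane_subalgebra[OF h y(1) yZ v(1) ne eta(1)]
      have "pfaffians_vanish {u \<in> h. \<eta> (bracket y u) = 0}"
      proof (rule pfaffians_vanish_if_small[OF _ hyp(3)])
        show "subspace {u \<in> h. \<eta> (bracket y u) = 0}" using hyp(1) by (simp add: lie_subalgebra_def)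
        show "bracket w z = 0" if "z \<in> center h" "w \<in> {u \<in> h. \<eta> (bracket y u) = 0}" for z w
          using center_commute[OF that(1)] that(2) by simp
        \<comment> \<open>Either dim h <= 6, so the hyperplane has dimension at most 5 = 2 + 3, or
          the centre has dimension at least 3 and 6 <= 3 + 3.\<close>
        show "dim {u \<in> h. \<eta> (bracket y u) = 0} \<le> dim (center h) + 3"
          using hyp(2) dimZ dimh False by auto
      qed
      then show ?thesis by (rule reduce[OF v(1) eta(1) ne])
    qed
  qed
qed

lemma lie_subalgebra_UNIV: "lie_subalgebra UNIV"
  by (simp add: lie_subalgebra_def)

text \<open>A stabilizer is the radical of B_xi, so its least dimension is n - 2r for the largest
  system size r; then c(g) = (n + n - 2r)/2.\<close>

lemma exists_maximal_system:
  obtains r where "c_number = real (n - r)" "2 * r \<le> n"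
    "\<exists>\<xi>\<in>dual_space. symplectic_system \<xi> r UNIV"
    "\<forall>\<xi>\<in>dual_space. \<forall>s. symplectic_system \<xi> s UNIV \<longrightarrow> s \<le> r"
proof -
  let ?S = "{s. \<exists>\<xi>\<in>dual_space. symplectic_system \<xi> s UNIV}"
  have stab: "{u \<in> UNIV. \<forall>v\<in>UNIV. \<xi> (bracket u v) = 0} = stabilizer \<xi>" for \<xi>
    by (simp add: stabilizer_def)
  have le: "2 * s + dim (stabilizer \<xi>) \<le> n" if "\<xi> \<in> dual_space" "symplectic_system \<xi> s UNIV" for \<xi> s
  proof -
    have "2 * s + dim (stabilizer \<xi>) \<le> dim UNIV"
    proof (rule symplectic_system_dim[OF that(1) subspace_UNIV subset_UNIV _ that(2)])
      show "\<xi> (bracket v u) = 0" if "u \<in> stabilizer \<xi>" for u v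
        using that dual_skew[OF \<open>\<xi> \<in> dual_space\<close>, of v u] by (simp add: stabilizer_def)
    qed
    then show ?thesis by (simp only: dim_UNIV_eq)
  qed
  have ex: "\<exists>s. symplectic_system \<xi> s UNIV \<and> n = 2 * s + dim (stabilizer \<xi>)" if "\<xi> \<in> dual_space" for \<xi>
    using exists_symplectic_system[OF that subspace_UNIV] unfolding stab dim_UNIV_eq .
  obtain \<zeta> where "\<zeta> \<in> dual_space" using exists_functional[OF independent_empty] by blast
  then have ne: "0 \<in> ?S" by auto
  have bound: "s \<le> n" if s: "s \<in> ?S" for s
  proof -
    obtain \<xi> where "\<xi> \<in> dual_space" "symplectic_system \<xi> s UNIV" using s by blast
    from le[OF this] show ?thesis by simp
  qed
  define r where "r = Max ?S"
  have fin: "finite ?S" using bound by (intro finite_subset[of ?S "{..n}"]) auto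
  have rS: "r \<in> ?S" unfolding r_def using Max_in[OF fin] ne by blast
  have max: "s \<le> r" if "s \<in> ?S" for s unfolding r_def using fin that by (rule Max_ge)
  obtain \<xi> where xi: "\<xi> \<in> dual_space" "symplectic_system \<xi> r UNIV" using rS by blast
  have "index = n - 2 * r"
    unfolding index_def
  proof (rule Least_equality)
    \<comment> \<open>The system that computes the radical of this form may a priori have a size
      \<open>s\<close> other than \<open>r\<close>. Maximality gives s <= r, and the bound from the
      system of size \<open>r\<close> gives the converse.\<close>
    obtain s where s: "symplectic_system \<xi> s UNIV" "n = 2 * s + dim (stabilizer \<xi>)" using ex[OF xi(1)] by blast
    have "s \<le> r" using max s(1) xi(1) by blast
    then have "n - 2 * r = dim (stabilizer \<xi>)" using s(2) le[OF xi] by simp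
    then show "\<exists>\<xi>\<in>dual_space. n - 2 * r = dim (stabilizer \<xi>)" using xi(1) by blast
  next
    fix d assume "\<exists>\<xi>\<in>dual_space. d = dim (stabilizer \<xi>)"
    then obtain \<zeta> where zeta: "\<zeta> \<in> dual_space" "d = dim (stabilizer \<zeta>)" by blast
    obtain s where s: "symplectic_system \<zeta> s UNIV" "n = 2 * s + dim (stabilizer \<zeta>)" using ex[OF zeta(1)] by blast
    have "s \<le> r" using max s(1) zeta(1) by blast
    then show "n - 2 * r \<le> d" using s(2) zeta(2) by simp
  qed
  moreover have "2 * r \<le> n" using le[OF xi] by simp
  ultimately have "c_number = real (n - r)"
    unfolding c_number_def dim_UNIV_eq by (simp add: of_nat_diff field_simps)
  then show ?thesis
  proof (rule that)
    show "2 * r \<le> n" by fact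
    show "\<exists>\<xi>\<in>dual_space. symplectic_system \<xi> r UNIV" using xi by blast
    show "\<forall>\<zeta>\<in>dual_space. \<forall>s. symplectic_system \<zeta> s UNIV \<longrightarrow> s \<le> r" using max by blast
  qed
qed

lemma achievable_c_number:
  assumes n7: "n \<le> 7"
  obtains c where "achievable c" "c_number = real c"
proof -
  obtain r where r: "c_number = real (n - r)" "2 * r \<le> n"
    "\<exists>\<xi>\<in>dual_space. symplectic_system \<xi> r UNIV"
    "\<forall>\<xi>\<in>dual_space. \<forall>s. symplectic_system \<xi> s UNIV \<longrightarrow> s \<le> r"
    by (rule exists_maximal_system)
  note U = lie_subalgebra_UNIV
  have lt: "2 * s < n" if "\<xi> \<in> dual_space" "symplectic_system \<xi> s UNIV" "s \<noteq> 0" for \<xi> s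
    using symplectic_system_bound[OF that(1) U that(2,3)] by (simp only: dim_UNIV_eq)
  have "r \<le> 3"
  proof (cases "r = 0")
    case False
    obtain \<xi> where "\<xi> \<in> dual_space" "symplectic_system \<xi> r UNIV" using r(3) by blast
    from lt[OF this False] show ?thesis using n7 by simp
  qed simp
  then consider "r = 0" | "r = 1" | "r = 2" | "r = 3" by linarith
  then have "achievable (n - r)"
  proof cases
    case 1
    have "bracket u v = 0" for u v
    proof (rule eq_0_if_functionals, rule ccontr)
      fix \<xi> assume xi: "\<xi> \<in> dual_space" and "\<xi> (bracket u v) \<noteq> 0"
      then have "symplectic_system \<xi> (Suc 0) UNIV" by auto
      then have "Suc 0 \<le> r" using bspec[OF r(4) xi] by blast
      then show False using 1 by simp
    qed
    then have "achievable (dim UNIV)" by (intro achievable_abelian subspace_UNIV)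
    then show ?thesis unfolding 1 dim_UNIV_eq by simp
  next
    case 2
    have "\<not> symplectic_system \<xi> 2 UNIV" if "\<xi> \<in> dual_space" for \<xi>
      using bspec[OF r(4) that] 2 by auto
    then have "pfaffians_vanish UNIV" by (rule pfaffians_vanish_if_no_system[OF subspace_UNIV])
    from achievable_pfaffians_vanish[OF U this] show ?thesis unfolding 2 dim_UNIV_eq .
  next
    case 3
    have no3: "\<not> symplectic_system \<xi> 3 UNIV" if "\<xi> \<in> dual_space" for \<xi>
      using bspec[OF r(4) that] 3 by auto
    have "dim UNIV \<le> 7" unfolding dim_UNIV_eq by (rule n7)
    from achievable_no_system_3[OF U this no3] show ?thesis unfolding 3 dim_UNIV_eq .
  next
    case 4
    then obtain \<xi> where xi: "\<xi> \<in> dual_space" "symplectic_system \<xi> 3 UNIV" using r(3) by blast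
    then have n: "n = 7" using lt[OF xi] n7 by simp
    obtain e f where "\<xi> (bracket e f) \<noteq> 0" using xi(2) by (auto simp: numeral_3_eq_3)
    then have "bracket e f \<noteq> 0" using dual_0[OF xi(1)] by auto
    then have "e \<notin> center UNIV" by (auto simp: center_def)
    then obtain y where y: "y \<notin> center UNIV" "\<And>u. bracket u y \<in> center UNIV"
      using exists_second_center[OF U UNIV_I, of e] by auto
    then obtain v where v: "bracket y v \<noteq> 0" by (auto simp: center_def)
    have yZ: "bracket y u \<in> center UNIV" for u
      using y(2)[of u] subspace_neg[OF subspace_center[OF subspace_UNIV]] bracket_skew[of y u] by simp
    obtain \<eta> where eta: "\<eta> \<in> dual_space" "\<eta> (bracket y v) = 1"
      by (rule exists_functional_nonzero[OF v])
    then have ne: "\<eta> (bracket y v) \<noteq> 0" by simp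
    let ?h = "{u \<in> UNIV. \<eta> (bracket y u) = 0}"
    note hyp = hyperplane_subalgebra[OF U UNIV_I yZ UNIV_I ne eta(1)]
    \<comment> \<open>A system of size three would need 6 < 6. The count for rank at most four
      therefore applies, and 6 - 2 = 7 - 3.\<close>
    have dim: "dim ?h = 6" using hyp(2) n by (simp only: dim_UNIV_eq)
    have "\<not> symplectic_system \<zeta> 3 ?h" if "\<zeta> \<in> dual_space" for \<zeta>
      using symplectic_system_bound[OF that hyp(1), of 3] dim by auto
    then show ?thesis using achievable_no_system_3[OF hyp(1)] dim n 4 by simp
  qed
  then show ?thesis using r(1) that by blast
qed

end

theorem mainTheorem2:
  fixes scale :: "complex \<Rightarrow> 'g::ab_group_add \<Rightarrow> 'g"
    and bracket :: "'g \<Rightarrow> 'g \<Rightarrow> 'g"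
    and n :: nat and x :: "nat \<Rightarrow> 'g"
  assumes "lie_algebra_with_basis scale bracket n x"
    and "lie_algebra.nilpotent scale bracket"
    and "vector_space.dim scale (UNIV :: 'g set) \<le> 7"
  shows "\<exists>M. lie_algebra_with_basis.complete_poisson_commutative_subalgebra scale bracket n x M \<and>
             (\<exists>G \<subseteq> poly_ring n. (\<forall>g\<in>G. total_degree g \<le> 2) \<and> M = generated_subalgebra G)"
proof -
  interpret nilpotent_lie_algebra scale bracket n x
    using assms(1,2) by (intro nilpotent_lie_algebra.intro nilpotent_lie_algebra_axioms.intro)
  have "n \<le> 7" using assms(3) by (simp only: dim_UNIV_eq)
  then obtain c where "achievable c" "c_number = real c" by (rule achievable_c_number)
  then show ?thesis by (rule complete_if_achievable)
qed

end
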